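(* Let $\mu_0=\sum_{i=1}^{N_0}a_i\delta_{x^{(i)}}\in\mathcal P(\mathbb R^{d_0})$ and $\mu_1=\sum_{j=1}^{N_1}b_j\delta_{y^{(j)}}\in\mathcal P(\mathbb R^{d_1})$ be finitely supported, $\varepsilon>0$, $M>M_{\mu_0,\mu_1}$, and $\Phi(A)=32\|A\|_F^2+\mathrm{OT}_{A,\varepsilon}(\mu_0,\mu_1)$. Assume that $\Phi$ is convex and $L$-smooth on $\mathcal D_M$, where $L=64$, and that, for every $A\in\mathcal D_M$, $\widetilde{\mathbf\Pi}^A$ is a $\delta$-oracle for $\mathbf\Pi^A$. Then the iterates $B_k$ of the fast gradient method with inexact oracle (described in the context, with $\widetilde D\Phi_{[A_k]}$ the approximate gradient defined there) satisfy \[\Phi(B_k)-\Phi(B^\star)\le\frac{2L\|B^\star\|_F^2}{(k+1)(k+2)}+3\delta',\] where $B^\star$ is a global minimizer of $\Phi$ and $\delta'=32M\delta\sum_{1\le i\le N_0,\,1\le j\le N_1}\|x^{(i)}\|\,\|y^{(j)}\|$. Moreover, for any $\eta>3\delta'$, the algorithm requires at most \[k=\left\lceil-\frac32+\frac12\sqrt{1+\frac{8L\|B^\star\|_F^2}{\eta-3\delta'}}\right\rceil\le\left\lceil-\frac32+\frac12\sqrt{1+\frac{128M^2}{\eta-3\delta'}}\right\rceil\] iterations to achieve an $\eta$-approximate solution.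
   Context: $\Pi(\mu_0,\mu_1)$ is the set of couplings; $\mathsf D_{\mathsf{KL}}$ is the Kullback–Leibler divergence; $\|\cdot\|_F$ is the Frobenius norm; $M_p(\mu)=\int\|x\|^pd\mu(x)$; $M_{\mu_0,\mu_1}=\sqrt{M_2(\mu_0)M_2(\mu_1)}$; $\mathcal D_M=\{A\in\mathbb R^{d_0\times d_1}:\|A\|_F\le M/2\}$. $c_A(x,y)=-4\|x\|^2\|y\|^2-32x^{\intercal}Ay$, $\mathrm{OT}_{A,\varepsilon}(\mu_0,\mu_1)=\inf_{\pi\in\Pi(\mu_0,\mu_1)}\int c_A\,d\pi+\varepsilon\mathsf D_{\mathsf{KL}}(\pi\|\mu_0\otimes\mu_1)$, $\pi^A$ is its unique optimal coupling and $\mathbf\Pi^A_{ij}=\pi^A(\{(x^{(i)},y^{(j)})\})$. A $\delta$-oracle for $\mathbf\Pi^A$ is a matrix $\widetilde{\mathbf\Pi}^A\in\mathbb R^{N_0\times N_1}$ with $\|\widetilde{\mathbf\Pi}^A-\mathbf\Pi^A\|_\infty<\delta$ (entrywise maximum). $L$-smooth on $\mathcal D_M$ means the gradient is $L$-Lipschitz on $\mathcal D_M$ (Frobenius norm). An $\eta$-approximate solution is $B$ with $\Phi(B)-\Phi(B^\star)\le\eta$. All minimizers of $\Phi$ lie in $\mathcal D_{M_{\mu_0,\mu_1}}$. Approximate gradient: $\widetilde D\Phi_{[A]}=64A-32\sum_{i,j}x^{(i)}(y^{(j)})^{\intercal}\widetilde{\mathbf\Pi}^A_{ij}$. Fast gradient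 method with inexact oracle: fix $L=64$, $\alpha_k=\frac{k+1}2$, $\tau_k=\frac2{k+3}$. Initialize $A_0=0$, $G_0=\widetilde D\Phi_{[A_0]}$, $W_0=\alpha_0G_0$. For $k=0,1,2,\dots$: $B_k=\min\left(1,\frac{M}{2\|A_k-L^{-1}G_k\|_F}\right)(A_k-L^{-1}G_k)$; $C_k=-\min\left(1,\frac{M}{2\|L^{-1}W_k\|_F}\right)L^{-1}W_k$; $A_{k+1}=\tau_kC_k+(1-\tau_k)B_k$; $G_{k+1}=\widetilde D\Phi_{[A_{k+1}]}$; $W_{k+1}=W_k+\alpha_{k+1}G_{k+1}$; with the convention $\min(1,M/0)=1$. *)

theory Defs
  imports "HOL-Probability.Probability"
begin

section \<open>Finitely supported measures, moments and couplings\<close>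

definition atomic_measure :: "('n::finite \<Rightarrow> real) \<Rightarrow> ('n \<Rightarrow> 'a::euclidean_space) \<Rightarrow> 'a measure" where
  "atomic_measure w z = distr (point_measure UNIV (\<lambda>i. ennreal (w i))) borel z"

text \<open>This is \<open>\<Sum>i. w i \<cdot> \<delta>(z i)\<close>, where \<open>return borel (z i)\<close> is the Dirac measure:\<close>

lemma emeasure_atomic_measure:
  assumes "S \<in> sets borel"
  shows "emeasure (atomic_measure w z) S
           = (\<Sum>i\<in>UNIV. ennreal (w i) * emeasure (return borel (z i)) S)"
proof -
  have "emeasure (atomic_measure w z) S
          = emeasure (point_measure UNIV (\<lambda>i. ennreal (w i))) (z -` S)"
    unfolding atomic_measure_def using assms
    by (subst emeasure_distr) (auto simp: space_point_measure)
  also have "\<dots> = (\<Sum>i\<in>z -` S. ennreal (w i))"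
    by (subst emeasure_point_measure_finite) auto
  also have "\<dots> = (\<Sum>i\<in>UNIV. ennreal (w i) * indicator S (z i))"
    by (rule sum.mono_neutral_cong_left) (auto simp: indicator_def)
  finally show ?thesis
    using assms by simp
qed

definition moment :: "nat \<Rightarrow> 'a::euclidean_space measure \<Rightarrow> real" where
  "moment p \<mu> = (\<integral>x. norm x ^ p \<partial>\<mu>)"

definition M_prod :: "'a::euclidean_space measure \<Rightarrow> 'b::euclidean_space measure \<Rightarrow> real" where
  "M_prod \<mu>0 \<mu>1 = sqrt (moment 2 \<mu>0 * moment 2 \<mu>1)"

definition couplings :: "'a measure \<Rightarrow> 'b measure \<Rightarrow> ('a \<times> 'b) measure set" where
  "couplings \<mu>0 \<mu>1 = {\<pi>. sets \<pi> = sets (\<mu>0 \<Otimes>\<^sub>M \<mu>1)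
                        \<and> distr \<pi> \<mu>0 fst = \<mu>0 \<and> distr \<pi> \<mu>1 snd = \<mu>1}"

text \<open>
  The library constant \<^const>\<open>KL_divergence\<close> takes the reference measure first, so that
  \<open>KL_divergence (exp 1) Q P\<close> is the integral of \<open>ln (dP/dQ)\<close> with respect to \<open>P\<close>. For
  probability measures \<open>P \<lless> Q\<close> the negative part of \<open>ln (dP/dQ)\<close> is always \<open>P\<close>-integrable, so
  non-integrability means that the integral is \<open>+\<infinity>\<close>.
\<close>

definition D_KL :: "'a measure \<Rightarrow> 'a measure \<Rightarrow> ereal" where
  "D_KL P Q = (if absolutely_continuous Q P \<and> integrable P (entropy_density (exp 1) Q P)
               then ereal (KL_divergence (exp 1) Q P) else \<infinity>)"


section \<open>The entropic transport problem and the objective\<close>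

text \<open>
  A \<open>d\<^sub>0 \<times> d\<^sub>1\<close> matrix has type \<open>real^'d1^'d0\<close>; the library norm and inner product on this type
  are the Frobenius ones:
\<close>

lemma norm_matrix_frobenius:
  fixes A :: "real^'d1::finite^'d0::finite"
  shows "norm A = sqrt (\<Sum>i\<in>UNIV. \<Sum>j\<in>UNIV. (A $ i $ j)\<^sup>2)"
  by (simp add: norm_vec_def L2_set_def sum_nonneg)

definition cost :: "real^'d1^'d0 \<Rightarrow> (real^'d0::finite) \<times> (real^'d1::finite) \<Rightarrow> real" where
  "cost A = (\<lambda>(x, y). - 4 * (norm x)\<^sup>2 * (norm y)\<^sup>2 - 32 * (x \<bullet> (A *v y)))"

definition OT_objective :: "real \<Rightarrow> (real^'d0::finite) measure \<Rightarrow> (real^'d1::finite) measure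
    \<Rightarrow> real^'d1^'d0 \<Rightarrow> ((real^'d0) \<times> (real^'d1)) measure \<Rightarrow> ereal" where
  "OT_objective \<epsilon> \<mu>0 \<mu>1 A \<pi>
     = ereal (\<integral>z. cost A z \<partial>\<pi>) + ereal \<epsilon> * D_KL \<pi> (\<mu>0 \<Otimes>\<^sub>M \<mu>1)"

definition OT :: "real \<Rightarrow> (real^'d0::finite) measure \<Rightarrow> (real^'d1::finite) measure
    \<Rightarrow> real^'d1^'d0 \<Rightarrow> ereal" where
  "OT \<epsilon> \<mu>0 \<mu>1 A = (INF \<pi>\<in>couplings \<mu>0 \<mu>1. OT_objective \<epsilon> \<mu>0 \<mu>1 A \<pi>)"

definition opt_coupling :: "real \<Rightarrow> (real^'d0::finite) measure \<Rightarrow> (real^'d1::finite) measure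
    \<Rightarrow> real^'d1^'d0 \<Rightarrow> ((real^'d0) \<times> (real^'d1)) measure" where
  "opt_coupling \<epsilon> \<mu>0 \<mu>1 A
     = (THE \<pi>. \<pi> \<in> couplings \<mu>0 \<mu>1 \<and> OT_objective \<epsilon> \<mu>0 \<mu>1 A \<pi> = OT \<epsilon> \<mu>0 \<mu>1 A)"

definition opt_plan :: "real \<Rightarrow> (real^'d0::finite) measure \<Rightarrow> (real^'d1::finite) measure
    \<Rightarrow> ('n0::finite \<Rightarrow> real^'d0) \<Rightarrow> ('n1::finite \<Rightarrow> real^'d1) \<Rightarrow> real^'d1^'d0 \<Rightarrow> real^'n1^'n0" where
  "opt_plan \<epsilon> \<mu>0 \<mu>1 x y A = (\<chi> i j. measure (opt_coupling \<epsilon> \<mu>0 \<mu>1 A) {(x i, y j)})"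

text \<open>
  For finitely supported probability measures \<^const>\<open>OT\<close> is finite (the product coupling has
  finite objective and the cost is bounded on the support), so \<^const>\<open>real_of_ereal\<close> loses nothing.
\<close>

definition Phi :: "real \<Rightarrow> (real^'d0::finite) measure \<Rightarrow> (real^'d1::finite) measure
    \<Rightarrow> real^'d1^'d0 \<Rightarrow> real" where
  "Phi \<epsilon> \<mu>0 \<mu>1 A = 32 * (norm A)\<^sup>2 + real_of_ereal (OT \<epsilon> \<mu>0 \<mu>1 A)"

definition D_ball :: "real \<Rightarrow> (real^'d1::finite^'d0::finite) set" where
  "D_ball M = {A. norm A \<le> M / 2}"

definition smooth_on :: "real \<Rightarrow> 'a::euclidean_space set \<Rightarrow> ('a \<Rightarrow> real) \<Rightarrow> bool" where
  "smooth_on L S f \<longleftrightarrow> (\<exists>G. (\<forall>A\<in>S. GDERIV f A :> G A) \<and> L-lipschitz_on S G)"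


section \<open>Fast gradient method with inexact oracle\<close>

definition max_norm :: "real^'n1::finite^'n0::finite \<Rightarrow> real" where
  "max_norm P = Max (range (\<lambda>(i, j). \<bar>P $ i $ j\<bar>))"

definition delta_oracle :: "real \<Rightarrow> real^'n1::finite^'n0::finite \<Rightarrow> real^'n1^'n0 \<Rightarrow> bool" where
  "delta_oracle \<delta> Pt P \<longleftrightarrow> max_norm (Pt - P) < \<delta>"

definition outer :: "real^'d0::finite \<Rightarrow> real^'d1::finite \<Rightarrow> real^'d1^'d0" where
  "outer u v = (\<chi> i j. u $ i * v $ j)"

definition approx_grad :: "('n0::finite \<Rightarrow> real^'d0::finite) \<Rightarrow> ('n1::finite \<Rightarrow> real^'d1::finite)
    \<Rightarrow> (real^'d1^'d0 \<Rightarrow> real^'n1^'n0) \<Rightarrow> real^'d1^'d0 \<Rightarrow> real^'d1^'d0" where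
  "approx_grad x y Pt A
     = 64 *\<^sub>R A - 32 *\<^sub>R (\<Sum>i\<in>UNIV. \<Sum>j\<in>UNIV. (Pt A $ i $ j) *\<^sub>R outer (x i) (y j))"

definition clip :: "real \<Rightarrow> 'a::euclidean_space \<Rightarrow> 'a" where
  "clip M Z = (if Z = 0 then 1 else min 1 (M / (2 * norm Z))) *\<^sub>R Z"

definition fgm_alpha :: "nat \<Rightarrow> real" where
  "fgm_alpha k = (real k + 1) / 2"

definition fgm_tau :: "nat \<Rightarrow> real" where
  "fgm_tau k = 2 / (real k + 3)"

definition fgm_B_step :: "real \<Rightarrow> real \<Rightarrow> ('a::euclidean_space \<Rightarrow> 'a) \<Rightarrow> 'a \<Rightarrow> 'a" where
  "fgm_B_step L M g A = clip M (A - inverse L *\<^sub>R g A)"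

definition fgm_C_step :: "real \<Rightarrow> real \<Rightarrow> 'a::euclidean_space \<Rightarrow> 'a" where
  "fgm_C_step L M W = - clip M (inverse L *\<^sub>R W)"

text \<open>The state after \<open>k\<close> steps is the pair \<open>(A\<^sub>k, W\<^sub>k)\<close>, and \<open>G\<^sub>k = g A\<^sub>k\<close>.\<close>

primrec fgm_state :: "real \<Rightarrow> real \<Rightarrow> ('a::euclidean_space \<Rightarrow> 'a) \<Rightarrow> nat \<Rightarrow> 'a \<times> 'a" where
  "fgm_state L M g 0 = (0, fgm_alpha 0 *\<^sub>R g 0)"
| "fgm_state L M g (Suc k) =
     (let (A, W) = fgm_state L M g k;
          B = fgm_B_step L M g A;
          C = fgm_C_step L M W;
          A' = fgm_tau k *\<^sub>R C + (1 - fgm_tau k) *\<^sub>R B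
      in (A', W + fgm_alpha (Suc k) *\<^sub>R g A'))"

definition fgm_B :: "real \<Rightarrow> real \<Rightarrow> ('a::euclidean_space \<Rightarrow> 'a) \<Rightarrow> nat \<Rightarrow> 'a" where
  "fgm_B L M g k = fgm_B_step L M g (fst (fgm_state L M g k))"

end

theory Submission
  imports Defs "HOL-Real_Asymp.Real_Asymp"
begin

text \<open>
  Optimal entropic plans exist and are unique by compactness and strict convexity, and each \<open>OT\<close> is an
  infimum of functions affine in \<open>A\<close>. Hence \<open>\<Phi>(A') \<le> \<Phi>(A) + \<langle>D, A' - A\<rangle> + 32\<parallel>A' - A\<parallel>\<^sup>2\<close> for the candidate
  gradient \<open>D\<close> built from the optimal plan, which must then be the gradient of \<open>\<Phi>\<close>. At a minimiser \<open>D = 0\<close>,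
  so Cauchy-Schwarz places it in the ball of radius \<open>M/2\<close>.

  For the fast gradient method let \<open>e\<close> bound the norm of the gradient error, so that \<open>\<delta>' = Me\<close>. The usual
  estimate sequence yields the gap \<open>2L\<parallel>B\<^sup>\<star>\<parallel>\<^sup>2/((k+1)(k+2)) + 2Me + (k+3)e\<^sup>2/6L\<close>, whose last term grows with
  \<open>k\<close>. It is at most \<open>Me\<close> as long as \<open>(k+3)e \<le> 6LM\<close>. Afterwards the momentum weight \<open>\<tau>\<^sub>k = 2/(k+3)\<close> is at most of order
  \<open>e/LM\<close>, and then a single gradient step cannot leave the sublevel set that the theorem claims.
\<close>

section \<open>The fast gradient method with inexact gradients\<close>

text \<open>\<open>clip M\<close> is the Euclidean projection onto the ball of radius
  \<open>M / 2\<close>, and \<open>inner_clip_le\<close> is its variational inequality. Outside the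
  ball \<open>Z - clip M Z\<close> is a nonnegative multiple of \<open>Z\<close>, and Cauchy-Schwarz
  bounds \<open>Z \<bullet> X\<close>.\<close>

lemma clip_closest_point:
  fixes Z :: "'a::euclidean_space"
  assumes "M > 0"
  shows norm_clip_le: "norm (clip M Z) \<le> M / 2"
    and inner_clip_le: "norm X \<le> M / 2 \<Longrightarrow> (Z - clip M Z) \<bullet> (X - clip M Z) \<le> 0"
proof -
  consider "norm Z \<le> M / 2" "clip M Z = Z"
    | "norm Z > M / 2" "clip M Z = (M / (2 * norm Z)) *\<^sub>R Z"
  proof (cases "norm Z \<le> M / 2")
    case True
    then have "Z \<noteq> 0 \<Longrightarrow> 1 \<le> M / (2 * norm Z)" by (simp add: field_simps)
    then show ?thesis using True that(1) by (simp add: clip_def)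
  next
    case False
    then have "Z \<noteq> 0" "M / (2 * norm Z) \<le> 1" using assms by (auto simp: divide_le_eq_1)
    then show ?thesis using False that(2) by (simp add: clip_def)
  qed
  note cs = this
  show "norm (clip M Z) \<le> M / 2"
    using cs by cases (use assms in \<open>auto simp: field_simps\<close>)
  assume X: "norm X \<le> M / 2"
  show "(Z - clip M Z) \<bullet> (X - clip M Z) \<le> 0"
    using cs
  proof cases
    case 2
    define t where "t = M / (2 * norm Z)"
    have Z: "norm Z > 0" using 2 assms by linarith
    have t: "t \<le> 1" "t * norm Z = M / 2"
      using 2 Z by (auto simp: t_def field_simps)
    have "Z \<bullet> X \<le> norm Z * (M / 2)"
      using norm_cauchy_schwarz[of Z X] mult_left_mono[OF X, of "norm Z"] by simp
    also have "\<dots> = Z \<bullet> (t *\<^sub>R Z)"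
      using t by (simp add: dot_square_norm power2_eq_square)
    finally have "Z \<bullet> (X - t *\<^sub>R Z) \<le> 0" by (simp add: inner_diff_right)
    then have "(1 - t) * (Z \<bullet> (X - t *\<^sub>R Z)) \<le> 0"
      using t by (simp add: mult_nonneg_nonpos)
    moreover have "Z - t *\<^sub>R Z = (1 - t) *\<^sub>R Z" by (simp add: scaleR_left_diff_distrib)
    ultimately show ?thesis using 2(2) t_def by simp
  qed auto
qed

text \<open>With exact gradient \<open>g\<close> and oracle \<open>h\<close>, smoothness and
  convexity enter only as \<open>upper\<close> and \<open>lower\<close> on the ball, and optimality
  of \<open>xs\<close> as \<open>grad_xs\<close>.\<close>

locale inexact_fgm =
  fixes L M e :: real and f :: "'a::euclidean_space \<Rightarrow> real" and g h :: "'a \<Rightarrow> 'a" and xs :: 'a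
  assumes L: "L > 0" and M: "M > 0"
    and upper: "\<And>x y. \<lbrakk>norm x \<le> M / 2; norm y \<le> M / 2\<rbrakk>
                  \<Longrightarrow> f y \<le> f x + g x \<bullet> (y - x) + L / 2 * (norm (y - x))\<^sup>2"
    and lower: "\<And>x y. \<lbrakk>norm x \<le> M / 2; norm y \<le> M / 2\<rbrakk> \<Longrightarrow> f x + g x \<bullet> (y - x) \<le> f y"
    and grad_error: "\<And>x. norm x \<le> M / 2 \<Longrightarrow> norm (h x - g x) \<le> e"
    and xs: "norm xs \<le> M / 2" and grad_xs: "g xs = 0"
begin

lemma e_nonneg: "0 \<le> e"
  using grad_error[OF xs] norm_ge_zero order_trans by blast

lemma norm_diff_le: "\<lbrakk>norm x \<le> M / 2; norm y \<le> M / 2\<rbrakk> \<Longrightarrow> norm (x - y) \<le> M"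
  using norm_triangle_ineq4[of x y] by linarith

text \<open>Points of the ball are at most \<open>M\<close> apart, so replacing the gradient by the
  oracle costs at most \<open>M * e\<close>, the later \<open>\<delta>'\<close>.\<close>

lemma inner_error_le:
  assumes "norm x \<le> M / 2" "norm y \<le> M / 2" "norm z \<le> M / 2"
  shows "\<bar>(h x - g x) \<bullet> (y - z)\<bar> \<le> M * e"
proof -
  have "\<bar>(h x - g x) \<bullet> (y - z)\<bar> \<le> norm (h x - g x) * norm (y - z)"
    by (rule Cauchy_Schwarz_ineq2)
  also have "\<dots> \<le> e * M"
    using grad_error norm_diff_le assms e_nonneg by (intro mult_mono) auto
  finally show ?thesis by (simp add: mult.commute)
qed

definition yb :: "'a \<Rightarrow> 'a" where "yb = fgm_B_step L M h"

lemma norm_yb: "norm (yb x) \<le> M / 2"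
  using norm_clip_le[OF M] by (simp add: yb_def fgm_B_step_def)

text \<open>The quadratic error \<open>e\<^sup>2/2L\<close> of one gradient step arises by completing the square in
  \<open>\<parallel>u - yb x\<parallel>\<close>, the distance to the competitor.\<close>

lemma gradient_step:
  assumes x: "norm x \<le> M / 2" and u: "norm u \<le> M / 2"
  shows "f (yb x) \<le> f x + g x \<bullet> (u - x) + L / 2 * (norm (u - x))\<^sup>2 + e\<^sup>2 / (2 * L)"
proof -
  define y where "y = yb x"
  have y: "norm y \<le> M / 2" unfolding y_def by (rule norm_yb)
  have "(x - inverse L *\<^sub>R h x - y) \<bullet> (u - y) \<le> 0"
    using inner_clip_le[OF M u] by (simp add: y_def yb_def fgm_B_step_def)
  then have "L * ((x - inverse L *\<^sub>R h x - y) \<bullet> (u - y)) \<le> 0"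
    using L by (simp add: mult_nonneg_nonpos)
  then have *: "L * ((x - y) \<bullet> (u - y)) \<le> h x \<bullet> (u - y)"
    using L by (simp add: inner_diff_left right_diff_distrib flip: mult.assoc)
  have sq: "(norm (u - x))\<^sup>2 = (norm (y - x))\<^sup>2 - 2 * ((x - y) \<bullet> (u - y)) + (norm (u - y))\<^sup>2"
    unfolding power2_norm_eq_inner by (simp add: inner_diff_left inner_diff_right inner_commute)
  have err: "(g x - h x) \<bullet> (y - u) \<le> e * norm (u - y)"
    using norm_cauchy_schwarz[of "g x - h x" "y - u"] grad_error[OF x]
      mult_right_mono[of "norm (g x - h x)" e "norm (u - y)"]
    by (simp add: norm_minus_commute)
  have "0 \<le> (L * norm (u - y) - e)\<^sup>2 / (2 * L)" using L by simp
  then have square: "e * norm (u - y) \<le> L / 2 * (norm (u - y))\<^sup>2 + e\<^sup>2 / (2 * L)"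
    using L by (simp add: power2_eq_square field_simps)
  have "f y \<le> f x + g x \<bullet> (y - x) + L / 2 * (norm (y - x))\<^sup>2"
    by (rule upper[OF x y])
  also have "g x \<bullet> (y - x) = g x \<bullet> (u - x) + (g x - h x) \<bullet> (y - u) - h x \<bullet> (u - y)"
    by (simp add: inner_diff_left inner_diff_right)
  also have "L / 2 * (norm (y - x))\<^sup>2
      = L / 2 * (norm (u - x))\<^sup>2 + L * ((x - y) \<bullet> (u - y)) - L / 2 * (norm (u - y))\<^sup>2"
    unfolding sq by (simp add: field_simps)
  finally show ?thesis using * err square unfolding y_def by linarith
qed

section \<open>The iterates and the ball that contains them\<close>

definition A :: "nat \<Rightarrow> 'a" where "A k = fst (fgm_state L M h k)"
definition W :: "nat \<Rightarrow> 'a" where "W k = snd (fgm_state L M h k)"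
definition C :: "nat \<Rightarrow> 'a" where "C k = fgm_C_step L M (W k)"

abbreviation B :: "nat \<Rightarrow> 'a" where "B k \<equiv> yb (A k)"

lemma fgm_B_eq: "fgm_B L M h k = B k"
  by (simp add: fgm_B_def A_def yb_def)

lemma A_0: "A 0 = 0" and W_0: "W 0 = (1/2) *\<^sub>R h 0"
  by (simp_all add: A_def W_def fgm_alpha_def)

lemma A_Suc: "A (Suc k) = fgm_tau k *\<^sub>R C k + (1 - fgm_tau k) *\<^sub>R B k"
  and W_Suc: "W (Suc k) = W k + fgm_alpha (Suc k) *\<^sub>R h (A (Suc k))"
  by (simp_all add: A_def W_def C_def yb_def Let_def split: prod.splits)

lemma norm_C: "norm (C k) \<le> M / 2"
  using norm_clip_le[OF M] by (simp add: C_def fgm_C_step_def)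

text \<open>\<open>C k\<close> minimises \<open>L / 2 * (norm x)\<^sup>2 + W k \<bullet> x\<close>
  over the ball, and strong convexity supplies the squared distance to \<open>C k\<close>.\<close>

lemma C_minimal:
  assumes "norm x \<le> M / 2"
  shows "L / 2 * (norm (C k))\<^sup>2 + W k \<bullet> C k + L / 2 * (norm (x - C k))\<^sup>2
           \<le> L / 2 * (norm x)\<^sup>2 + W k \<bullet> x"
proof -
  define w where "w = inverse L *\<^sub>R W k"
  have C: "clip M w = - C k" by (simp add: C_def fgm_C_step_def w_def)
  \<comment> \<open>The ball is symmetric, so \<open>- x\<close> is an admissible competitor for the
    projection of \<open>w\<close>, while \<open>C k\<close> is minus that projection.\<close>
  have "(w - clip M w) \<bullet> (- x - clip M w) \<le> 0"
    using assms by (intro inner_clip_le) (auto simp: M)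
  then have "L * ((w + C k) \<bullet> (C k - x)) \<le> 0"
    using L by (simp add: C mult_nonneg_nonpos)
  also have "L * ((w + C k) \<bullet> (C k - x)) = W k \<bullet> (C k - x) + L * (C k \<bullet> (C k - x))"
    using L by (simp add: w_def inner_add_left distrib_left)
  finally show ?thesis
    unfolding power2_norm_eq_inner
    by (simp add: inner_diff_left inner_diff_right inner_commute field_simps)
qed

lemma norm_convex_comb:
  assumes "norm x \<le> M / 2" "norm (y::'a) \<le> M / 2" "0 \<le> t" "t \<le> 1"
  shows "norm (t *\<^sub>R x + (1 - t) *\<^sub>R y) \<le> M / 2"
  using convexD[OF convex_cball[of 0 "M/2"], of x y t "1 - t"] assms by simp

lemma tau_bounds: "0 \<le> fgm_tau k" "fgm_tau k \<le> 1"
  by (simp_all add: fgm_tau_def)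

lemma norm_A: "norm (A k) \<le> M / 2"
proof (cases k)
  case (Suc n)
  then show ?thesis
    using norm_convex_comb[OF norm_C norm_yb tau_bounds] by (simp add: A_Suc)
qed (simp add: A_0 M less_imp_le)

section \<open>Weights, accumulated errors and the estimate sequence\<close>

definition S :: "nat \<Rightarrow> real" where "S k = (real k + 1) * (real k + 2) / 4"

lemma S_pos: "S k > 0"
  unfolding S_def by (intro divide_pos_pos mult_pos_pos) auto

text \<open>Thus \<open>S k\<close> is the sum of \<open>fgm_alpha i\<close> over
  \<open>i \<le> k\<close>, and \<open>fgm_tau k\<close> is the share of the newest weight in
  \<open>S (Suc k)\<close>.\<close>

lemma S_0: "S 0 = 1/2"
  and S_Suc: "S (Suc k) = S k + fgm_alpha (Suc k)"
  and tau_S: "fgm_tau k * S (Suc k) = fgm_alpha (Suc k)"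
  by (simp_all add: S_def fgm_alpha_def fgm_tau_def field_simps)

text \<open>The compatibility of weights and step size behind acceleration: it lets the strong
  convexity term of \<open>C_minimal\<close> absorb the quadratic remainder of a gradient
  step.\<close>

lemma tau_sq_S: "(fgm_tau k)\<^sup>2 * S (Suc k) \<le> 1"
proof -
  have "(fgm_tau k)\<^sup>2 * S (Suc k) = fgm_tau k * fgm_alpha (Suc k)"
    unfolding tau_S[symmetric] by (simp add: power2_eq_square)
  also have "\<dots> \<le> 1" by (simp add: fgm_tau_def fgm_alpha_def field_simps)
  finally show ?thesis .
qed

text \<open>Closed form of the errors collected up to step \<open>k\<close>: the \<open>S i\<close>
  with \<open>i \<le> k\<close> add up to \<open>(k + 3) / 3 * S k\<close>.\<close>

definition E :: "nat \<Rightarrow> real" where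
  "E k = S k * (M * e) + (real k + 3) / 3 * S k * (e\<^sup>2 / (2 * L))"

lemma E_Suc: "E (Suc k) = E k + fgm_alpha (Suc k) * (M * e) + S (Suc k) * (e\<^sup>2 / (2 * L))"
proof -
  have "(real (Suc k) + 3) / 3 * S (Suc k) = (real k + 3) / 3 * S k + S (Suc k)"
    by (simp add: S_def field_simps)
  then have "E (Suc k) = S (Suc k) * (M * e) + ((real k + 3) / 3 * S k + S (Suc k)) * (e\<^sup>2 / (2 * L))"
    unfolding E_def by (simp only:)
  then show ?thesis
    unfolding E_def S_Suc by (simp only: distrib_right add_ac)
qed

text \<open>\<open>W k \<bullet> x + c\<close> is the weighted sum of the inexact linear models of
  \<open>f\<close>. Adding the quadratic makes it an upper estimate for the value at
  \<open>B k\<close>, and inexact convexity makes it a lower estimate for \<open>f\<close>. The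
  constant \<open>c\<close> may stay unspecified because it cancels when both are combined.\<close>

lemma estimate_sequence:
  "\<exists>c. (\<forall>x. norm x \<le> M / 2 \<longrightarrow> S k * f (B k) \<le> L / 2 * (norm x)\<^sup>2 + W k \<bullet> x + c + E k)
     \<and> (\<forall>x. norm x \<le> M / 2 \<longrightarrow> W k \<bullet> x + c \<le> S k * (f x + M * e))"
proof (induction k)
  case 0
  have "S 0 * f (B 0) \<le> L / 2 * (norm x)\<^sup>2 + W 0 \<bullet> x + f 0 / 2 + E 0"
    if x: "norm x \<le> M / 2" for x
  proof -
    have 1: "f (B 0) \<le> f 0 + g 0 \<bullet> x + L / 2 * (norm x)\<^sup>2 + e\<^sup>2 / (2 * L)"
      using gradient_step[of 0 x] x M by (simp add: A_0)
    have 2: "g 0 \<bullet> x \<le> h 0 \<bullet> x + M * e"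
      using inner_error_le[of 0 x 0] x M by (simp add: inner_diff_left)
    have 3: "0 \<le> L / 2 * (norm x)\<^sup>2" using L by simp
    show ?thesis using 1 2 3 by (simp add: E_def S_0 W_0)
  qed
  moreover have "W 0 \<bullet> x + f 0 / 2 \<le> S 0 * (f x + M * e)" if x: "norm x \<le> M / 2" for x
    using inner_error_le[of 0 x 0] lower[of 0 x] x M by (simp add: inner_diff_left S_0 W_0)
  ultimately show ?case by blast
next
  case (Suc k)
  then obtain c where
    c1: "\<And>x. norm x \<le> M / 2 \<Longrightarrow> S k * f (B k) \<le> L / 2 * (norm x)\<^sup>2 + W k \<bullet> x + c + E k" and
    c2: "\<And>x. norm x \<le> M / 2 \<Longrightarrow> W k \<bullet> x + c \<le> S k * (f x + M * e)"
    by blast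
  define x' where "x' = A (Suc k)"
  define \<tau> where "\<tau> = fgm_tau k"
  define \<alpha> where "\<alpha> = fgm_alpha (Suc k)"
  have \<alpha>: "\<alpha> \<ge> 0" by (simp add: \<alpha>_def fgm_alpha_def)
  have x': "norm x' \<le> M / 2" unfolding x'_def by (rule norm_A)
  have ts: "\<tau> * S (Suc k) = \<alpha>" "S k = S (Suc k) - \<alpha>"
    unfolding \<tau>_def \<alpha>_def by (rule tau_S) (simp add: S_Suc)
  have W': "W (Suc k) = W k + \<alpha> *\<^sub>R h x'"
    by (simp add: W_Suc x'_def \<alpha>_def)
  define c' where "c' = c + \<alpha> * (f x' - h x' \<bullet> x')"
  have "S (Suc k) * f (B (Suc k)) \<le> L / 2 * (norm x)\<^sup>2 + W (Suc k) \<bullet> x + c' + E (Suc k)"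
    if x: "norm x \<le> M / 2" for x
  proof -
    \<comment> \<open>\<open>u\<close> repeats the combination defining \<open>A (Suc k)\<close>
      with \<open>x\<close> in place of \<open>C k\<close>, so that \<open>u - x'\<close> is
      \<open>\<tau>\<close> times \<open>x - C k\<close>.\<close>
    define u where "u = \<tau> *\<^sub>R x + (1 - \<tau>) *\<^sub>R B k"
    have u: "norm u \<le> M / 2"
      unfolding u_def \<tau>_def by (intro norm_convex_comb x norm_yb tau_bounds)
    have ux': "u - x' = \<tau> *\<^sub>R (x - C k)"
      by (simp add: u_def x'_def A_Suc \<tau>_def algebra_simps)
    have norm_ux': "(norm (u - x'))\<^sup>2 = \<tau>\<^sup>2 * (norm (x - C k))\<^sup>2"
      by (simp add: ux' power_mult_distrib)
    \<comment> \<open>This splits the linear term at \<open>u\<close> into weight \<open>S k\<close>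
      on the old iterate and weight \<open>\<alpha>\<close> on the new linear model.\<close>
    have weights: "S (Suc k) *\<^sub>R (u - x') = S k *\<^sub>R (B k - x') + \<alpha> *\<^sub>R (x - x')"
      unfolding u_def ts(2) by (simp add: scaleR_right_distrib scaleR_right_diff_distrib
          scaleR_left_diff_distrib ts(1) right_diff_distrib mult.commute[of "S (Suc k)"])
    have "S (Suc k) * f (B (Suc k))
        \<le> S (Suc k) * (f x' + g x' \<bullet> (u - x') + L / 2 * (norm (u - x'))\<^sup>2 + e\<^sup>2 / (2 * L))"
      using gradient_step[OF x' u] S_pos[of "Suc k"] by (simp add: x'_def)
    also have "\<dots> = S (Suc k) * f x' + g x' \<bullet> (S (Suc k) *\<^sub>R (u - x'))
        + L / 2 * ((\<tau>\<^sup>2 * S (Suc k)) * (norm (x - C k))\<^sup>2) + S (Suc k) * (e\<^sup>2 / (2 * L))"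
      unfolding norm_ux' by (simp add: algebra_simps)
    also have "\<dots> \<le> S (Suc k) * f x' + g x' \<bullet> (S (Suc k) *\<^sub>R (u - x'))
        + L / 2 * (norm (x - C k))\<^sup>2 + S (Suc k) * (e\<^sup>2 / (2 * L))"
      using L tau_sq_S[of k] mult_right_mono[of "\<tau>\<^sup>2 * S (Suc k)" 1 "(norm (x - C k))\<^sup>2"]
      by (simp add: \<tau>_def)
    also have "g x' \<bullet> (S (Suc k) *\<^sub>R (u - x')) = S k * (g x' \<bullet> (B k - x')) + \<alpha> * (g x' \<bullet> (x - x'))"
      by (simp add: weights inner_add_right)
    finally have 1: "S (Suc k) * f (B (Suc k)) \<le> S k * (f x' + g x' \<bullet> (B k - x'))
        + \<alpha> * (f x' + g x' \<bullet> (x - x')) + L / 2 * (norm (x - C k))\<^sup>2 + S (Suc k) * (e\<^sup>2 / (2 * L))"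
      unfolding ts(2) by (simp add: algebra_simps)
    have 2: "S k * (f x' + g x' \<bullet> (B k - x')) \<le> S k * f (B k)"
      using lower[OF x' norm_yb] S_pos[of k] by simp
    have "g x' \<bullet> (x - x') \<le> h x' \<bullet> (x - x') + M * e"
      using inner_error_le[OF x' x x'] by (simp add: inner_diff_left)
    then have 3: "\<alpha> * (f x' + g x' \<bullet> (x - x')) \<le> \<alpha> * (f x' + h x' \<bullet> (x - x')) + \<alpha> * (M * e)"
      using \<alpha> by (simp add: mult_left_mono flip: distrib_left)
    have 4: "\<alpha> * (f x' + h x' \<bullet> (x - x')) + W k \<bullet> x + c = W (Suc k) \<bullet> x + c'"
      by (simp add: W' c'_def inner_add_left inner_diff_right algebra_simps)
    \<comment> \<open>The induction hypothesis is applied at \<open>C k\<close>, and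
      \<open>C_minimal\<close> then passes from \<open>C k\<close> to \<open>x\<close>, paying for
      the squared distance in \<open>1\<close>.\<close>
    show ?thesis
      using 1 2 3 4 c1[OF norm_C, of k] C_minimal[OF x, of k] E_Suc[of k, folded \<alpha>_def] by linarith
  qed
  moreover have "W (Suc k) \<bullet> x + c' \<le> S (Suc k) * (f x + M * e)" if x: "norm x \<le> M / 2" for x
  proof -
    have "f x' + h x' \<bullet> (x - x') \<le> f x + M * e"
      using inner_error_le[OF x' x x'] lower[OF x' x] by (simp add: inner_diff_left)
    then have "\<alpha> * (f x' + h x' \<bullet> (x - x')) \<le> \<alpha> * (f x + M * e)"
      using \<alpha> by (simp add: mult_left_mono)
    moreover have "W (Suc k) \<bullet> x + c' = W k \<bullet> x + c + \<alpha> * (f x' + h x' \<bullet> (x - x'))"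
      by (simp add: W' c'_def inner_add_left inner_diff_right algebra_simps)
    ultimately show ?thesis
      using c2[OF x] unfolding ts(2) by (simp add: algebra_simps)
  qed
  ultimately show ?case by blast
qed

section \<open>From the estimate sequence to a bound on the gap\<close>

definition b :: "nat \<Rightarrow> real" where
  "b k = 2 * L * (norm xs)\<^sup>2 / ((real k + 1) * (real k + 2))"

text \<open>Both halves of \<open>estimate_sequence\<close>, added at \<open>xs\<close>, contribute
  one \<open>M * e\<close> each after division by \<open>S k\<close>. The growing term is the second
  part of \<open>E k\<close>, and \<open>b k\<close> is \<open>L / 2 * (norm xs)\<^sup>2\<close>
  divided by \<open>S k\<close>.\<close>

lemma gap_accelerated: "f (B k) - f xs \<le> b k + 2 * (M * e) + (real k + 3) * e\<^sup>2 / (6 * L)"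
proof -
  obtain c where "S k * f (B k) \<le> L / 2 * (norm xs)\<^sup>2 + W k \<bullet> xs + c + E k"
    and "W k \<bullet> xs + c \<le> S k * (f xs + M * e)"
    using estimate_sequence xs by meson
  then have "S k * f (B k) \<le> L / 2 * (norm xs)\<^sup>2 + S k * (f xs + M * e) + E k"
    by linarith
  also have "L / 2 * (norm xs)\<^sup>2 = S k * b k"
  proof -
    have *: "L / 2 * n = p * q / 4 * (2 * L * n / (p * q))" if "p > 0" "q > 0" for n p q :: real
      using that by simp
    show ?thesis unfolding S_def b_def by (rule *) auto
  qed
  also have "S k * b k + S k * (f xs + M * e) + E k
      = S k * (b k + f xs + 2 * (M * e) + (real k + 3) * e\<^sup>2 / (6 * L))"
    using L by (simp add: E_def field_simps)
  finally show ?thesis using S_pos[of k] by (simp add: mult_le_cancel_left_pos)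
qed

text \<open>Here the competitor moves from \<open>B k\<close> towards the minimiser, which makes the gradient step
  contract the gap; the extrapolation only contributes through \<open>\<tau>\<close>.\<close>

lemma gap_contraction:
  assumes "0 \<le> s" "s \<le> 1"
  shows "f (B (Suc k)) - f xs
           \<le> (1 - s) * (f (B k) - f xs) + L / 2 * ((s + fgm_tau k) * M)\<^sup>2 + e\<^sup>2 / (2 * L)"
proof -
  define x' where "x' = A (Suc k)"
  have x': "norm x' \<le> M / 2" unfolding x'_def by (rule norm_A)
  define u where "u = s *\<^sub>R xs + (1 - s) *\<^sub>R B k"
  have u: "norm u \<le> M / 2"
    unfolding u_def by (intro norm_convex_comb xs norm_yb assms)
  have 1: "f (B (Suc k)) \<le> f x' + g x' \<bullet> (u - x') + L / 2 * (norm (u - x'))\<^sup>2 + e\<^sup>2 / (2 * L)"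
    using gradient_step[OF x' u] by (simp add: x'_def)
  have "f x' + g x' \<bullet> (u - x')
      = s * (f x' + g x' \<bullet> (xs - x')) + (1 - s) * (f x' + g x' \<bullet> (B k - x'))"
    by (simp add: u_def inner_add_right inner_diff_right algebra_simps)
  also have "\<dots> \<le> s * f xs + (1 - s) * f (B k)"
    using lower[OF x' xs] lower[OF x' norm_yb] assms by (intro add_mono mult_left_mono) auto
  finally have 2: "f x' + g x' \<bullet> (u - x') \<le> s * f xs + (1 - s) * f (B k)" .
  have "norm (u - x') = norm (s *\<^sub>R (xs - B k) - fgm_tau k *\<^sub>R (C k - B k))"
    by (simp add: u_def x'_def A_Suc algebra_simps)
  also have "\<dots> \<le> s * norm (xs - B k) + fgm_tau k * norm (C k - B k)"
    using norm_triangle_ineq4[of "s *\<^sub>R (xs - B k)" "fgm_tau k *\<^sub>R (C k - B k)"] assms tau_bounds[of k]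
    by simp
  also have "\<dots> \<le> s * M + fgm_tau k * M"
    using assms tau_bounds[of k] by (intro add_mono mult_left_mono norm_diff_le xs norm_yb norm_C) auto
  finally have "(norm (u - x'))\<^sup>2 \<le> ((s + fgm_tau k) * M)\<^sup>2"
    by (intro power_mono) (auto simp: algebra_simps)
  then have "L / 2 * (norm (u - x'))\<^sup>2 \<le> L / 2 * ((s + fgm_tau k) * M)\<^sup>2"
    using L by simp
  with 1 2 show ?thesis by (simp add: algebra_simps)
qed

text \<open>The gradient vanishes at \<open>xs\<close>, so only the quadratic term of
  \<open>upper\<close> remains. This settles the case \<open>e > L * M\<close>.\<close>

lemma gap_trivial: "f (B k) - f xs \<le> L / 2 * M\<^sup>2"
proof -
  have "(norm (B k - xs))\<^sup>2 \<le> M\<^sup>2"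
    by (intro power_mono norm_diff_le norm_yb xs) auto
  then have "L / 2 * (norm (B k - xs))\<^sup>2 \<le> L / 2 * M\<^sup>2" using L by simp
  then show ?thesis using upper[OF xs norm_yb, of "A k"] grad_xs by simp
qed

lemma b_nonneg: "0 \<le> b k"
  using L by (simp add: b_def)

text \<open>The target bound itself shrinks with \<open>k\<close>; its drop decays cubically, so a
  late step can make up for it.\<close>

lemma b_decrease: "b k - b (Suc k) \<le> L * M\<^sup>2 / ((real k + 1) * (real k + 2) * (real k + 3))"
proof -
  have "(norm xs)\<^sup>2 \<le> (M / 2)\<^sup>2" using xs by (intro power_mono) auto
  then have n: "4 * (norm xs)\<^sup>2 \<le> M\<^sup>2" by (simp add: power_divide)
  have "b k - b (Suc k) = L * (4 * (norm xs)\<^sup>2) / ((real k + 1) * (real k + 2) * (real k + 3))"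
    unfolding b_def by (simp add: divide_simps) (simp add: algebra_simps)
  also have "\<dots> \<le> L * M\<^sup>2 / ((real k + 1) * (real k + 2) * (real k + 3))"
    using n L by (intro divide_right_mono mult_left_mono) auto
  finally show ?thesis .
qed

text \<open>Gradient errors accumulate along the accelerated scheme, so \<open>gap_accelerated\<close> suffices only
  for \<open>(k + 3) e \<le> 6LM\<close>. Later the momentum is so weak that one step with
  \<open>s = e / (LM)\<close> in \<open>gap_contraction\<close> preserves the bound.\<close>

theorem gap_bound: "f (B k) - f xs \<le> b k + 3 * (M * e)"
proof (cases "e \<le> L * M")
  case False
  then have "L * M * M \<le> e * M" using M by (intro mult_right_mono) auto
  moreover have "0 \<le> M * e" using M e_nonneg by simp
  ultimately show ?thesis
    using gap_trivial[of k] b_nonneg[of k] by (simp add: power2_eq_square mult_ac)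
next
  \<comment> \<open>This assumption puts index \<open>0\<close> into the early regime and makes
    \<open>r = e / (L * M)\<close> at most \<open>1\<close>, hence an admissible step towards
    \<open>xs\<close>.\<close>
  case small: True
  have early: "f (B k) - f xs \<le> b k + 3 * (M * e)" if "(real k + 3) * e \<le> 6 * L * M" for k
  proof -
    have "(real k + 3) * e * e \<le> 6 * L * M * e"
      using that e_nonneg by (rule mult_right_mono)
    then have "(real k + 3) * e\<^sup>2 / (6 * L) \<le> M * e"
      using L by (simp add: field_simps power2_eq_square)
    then show ?thesis using gap_accelerated[of k] by linarith
  qed
  show ?thesis
  proof (induction k)
    case 0
    have "0 \<le> L * M" using L M by simp
    then show ?case using small by (intro early) simp
  next
    case (Suc k)
    show ?case
    proof (cases "(real (Suc k) + 3) * e \<le> 6 * L * M")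
      case True
      then show ?thesis by (rule early)
    next
      case late: False
      define n where "n = real k + 4"
      define r where "r = e / (L * M)"
      have LM: "L * M > 0" using L M by simp
      have n: "n \<ge> 4" and nr: "n * r > 6"
        using late LM by (simp_all add: n_def r_def field_simps)
      have r: "0 < r" "r \<le> 1"
        using zero_less_mult_pos[of n r] nr n small LM by (linarith, simp add: r_def)
      have e: "e = r * (L * M)" using L M by (simp add: r_def)
      \<comment> \<open>The factor \<open>4/9\<close> is \<open>8/3\<close> divided by the
        \<open>6\<close> in \<open>n * r > 6\<close>.\<close>
      have "fgm_tau k * n = 2 + 2 / (real k + 3)"
        by (simp add: fgm_tau_def n_def field_simps)
      also have "\<dots> \<le> 8 / 3" by (simp add: field_simps)
      also have "\<dots> \<le> (4/9 * r) * n" using nr by simp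
      finally have tau: "fgm_tau k \<le> 4/9 * r" using n by simp
      have "((r + fgm_tau k) * M)\<^sup>2 \<le> ((13/9 * r) * M)\<^sup>2"
        using tau r tau_bounds M by (intro power_mono mult_right_mono) auto
      then have 1: "L / 2 * ((r + fgm_tau k) * M)\<^sup>2 \<le> L / 2 * ((13/9 * r) * M)\<^sup>2"
        using L by simp
      have "(1 - r) * (f (B k) - f xs) \<le> (1 - r) * (b k + 3 * (M * e))"
        using Suc.IH r by (intro mult_left_mono) auto
      also have "\<dots> \<le> b k + (1 - r) * (3 * (M * e))"
        using b_nonneg[of k] r by (simp add: algebra_simps)
      finally have 2: "(1 - r) * (f (B k) - f xs) \<le> b k + (1 - r) * (3 * (M * e))" .
      \<comment> \<open>The \<open>36\<close> is the square of that \<open>6\<close>, so it cancels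
        and leaves \<open>1 \<le> r\<^sup>2 * N\<close>, where \<open>N\<close> is the denominator
        in \<open>b_decrease\<close>.\<close>
      have cubic: "n\<^sup>2 \<le> 36 * ((n - 3) * (n - 2) * (n - 1))"
      proof -
        have "n * n \<le> (n - 1) * (n * 2)" using n by (simp add: mult_le_cancel_left algebra_simps)
        also have "\<dots> \<le> (n - 1) * ((n - 2) * 4)" using n by (intro mult_left_mono) auto
        also have "\<dots> \<le> (n - 1) * ((n - 2) * (36 * (n - 3)))" using n by (intro mult_left_mono) auto
        finally show ?thesis by (simp add: power2_eq_square mult_ac)
      qed
      define N where "N = (n - 3) * (n - 2) * (n - 1)"
      have "36 \<le> (n * r)\<^sup>2"
        using power_mono[of 6 "n * r" 2] nr by simp
      also have "\<dots> \<le> 36 * N * r\<^sup>2"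
        using mult_right_mono[OF cubic, of "r\<^sup>2"] by (simp add: power_mult_distrib N_def)
      finally have "1 \<le> r\<^sup>2 * N" by (simp add: mult.commute)
      then have "L * M\<^sup>2 * 1 \<le> L * M\<^sup>2 * (r\<^sup>2 * N)"
        using L by (intro mult_left_mono) auto
      moreover have "0 < N" using n by (simp add: N_def)
      ultimately have "L * M\<^sup>2 / N \<le> L * M\<^sup>2 * r\<^sup>2"
        by (simp add: pos_divide_le_eq mult.assoc)
      then have 3: "b k - b (Suc k) \<le> L * M\<^sup>2 * r\<^sup>2"
        using b_decrease[of k] by (simp add: n_def N_def add.commute)
      \<comment> \<open>In units of \<open>L * M\<^sup>2 * r\<^sup>2\<close> the contraction gains
        \<open>3\<close> and the two remainders cost \<open>125/81\<close>. The surplus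
        \<open>118/81\<close> exceeds \<open>1\<close>, which covers the drop of \<open>b\<close> in
        \<open>3\<close>.\<close>
      have 4: "(1 - r) * (3 * (M * e)) + L / 2 * ((13/9 * r) * M)\<^sup>2 + e\<^sup>2 / (2 * L)
          = 3 * (M * e) - (118/81) * (L * M\<^sup>2 * r\<^sup>2)"
        using L by (simp add: e field_simps power2_eq_square)
      have "0 \<le> L * M\<^sup>2 * r\<^sup>2" using L by simp
      then show ?thesis
        using gap_contraction[of r k] r 1 2 3 4 by linarith
    qed
  qed
qed

end

section \<open>Finitely supported measures\<close>

lemma sets_atomic_measure [simp, measurable_cong]: "sets (atomic_measure w z) = sets borel"
  by (simp add: atomic_measure_def)

lemma space_atomic_measure [simp]: "space (atomic_measure w z) = UNIV"
  by (simp add: atomic_measure_def)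

lemma emeasure_atomic_measure_real:
  assumes "\<And>i. 0 \<le> w i" "X \<in> sets borel"
  shows "emeasure (atomic_measure w z) X = ennreal (\<Sum>i\<in>UNIV. w i * indicator X (z i))"
proof -
  have "emeasure (atomic_measure w z) X = (\<Sum>i\<in>UNIV. ennreal (w i * indicator X (z i)))"
    unfolding emeasure_atomic_measure[OF assms(2)]
    by (intro sum.cong refl) (use assms in \<open>auto simp: indicator_def\<close>)
  also have "\<dots> = ennreal (\<Sum>i\<in>UNIV. w i * indicator X (z i))"
    using assms by (intro sum_ennreal) auto
  finally show ?thesis .
qed

lemma prob_space_atomic_measure:
  assumes "\<And>i. 0 \<le> w i" "(\<Sum>i\<in>UNIV. w i) = 1"
  shows "prob_space (atomic_measure w z)"
  by (rule prob_spaceI) (use assms in \<open>simp add: emeasure_atomic_measure_real\<close>)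

lemma emeasure_atomic_measure_singleton:
  assumes "\<And>i. 0 \<le> w i" "inj z"
  shows "emeasure (atomic_measure w z) {z i} = ennreal (w i)"
proof -
  have "(\<Sum>k\<in>UNIV. w k * indicator {z i} (z k)) = (\<Sum>k\<in>UNIV. if k = i then w k else 0)"
    using assms(2) by (intro sum.cong) (auto simp: inj_eq indicator_def)
  then show ?thesis using assms(1) by (simp add: emeasure_atomic_measure_real)
qed

lemma measure_atomic_measure_singleton:
  assumes "\<And>i. 0 \<le> w i" "inj z"
  shows "measure (atomic_measure w z) {z i} = w i"
  unfolding measure_def using emeasure_atomic_measure_singleton[of w z i] assms by simp

lemma measurable_point_measure_UNIV: "z \<in> measurable (point_measure UNIV w) borel"
  by (simp add: measurable_def space_point_measure sets_point_measure)

lemma integral_atomic_measure: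
  fixes f :: "'a::euclidean_space \<Rightarrow> real"
  assumes "\<And>i. 0 \<le> w i" "f \<in> borel_measurable borel"
  shows "(\<integral>u. f u \<partial>atomic_measure w z) = (\<Sum>i\<in>UNIV. w i * f (z i))"
  unfolding atomic_measure_def using assms
  by (subst integral_distr[OF measurable_point_measure_UNIV])
     (auto simp: lebesgue_integral_point_measure_finite)

lemma integrable_atomic_measure:
  fixes f :: "'a::euclidean_space \<Rightarrow> real"
  assumes "f \<in> borel_measurable borel"
  shows "integrable (atomic_measure w z) f"
  unfolding atomic_measure_def
  by (subst integrable_distr_eq[OF measurable_point_measure_UNIV assms])
     (simp add: integrable_point_measure_finite)

text \<open>Off the finite range of \<open>z\<close> there is no mass, so a set is measured by
  summing over the singletons it contains; injectivity keeps the atoms apart.\<close>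

lemma eq_atomic_measureI:
  fixes z :: "'n::finite \<Rightarrow> 'a::euclidean_space"
  assumes "finite_measure \<mu>" and sets: "sets \<mu> = sets borel"
    and null: "emeasure \<mu> (- range z) = 0" and "inj z"
  shows "\<mu> = atomic_measure (\<lambda>i. measure \<mu> {z i}) z"
proof (rule measure_eqI)
  fix X assume X: "X \<in> sets \<mu>"
  interpret finite_measure \<mu> by fact
  have R: "X \<inter> range z = z ` (z -` X)" by auto
  have "range z \<in> sets borel" by (intro borel_closed finite_imp_closed) simp
  then have finR: "X - range z \<in> sets \<mu>" "- range z \<in> sets \<mu>" "X \<inter> range z \<in> sets \<mu>"
    using X by (auto simp: sets intro: borel_comp)
  have "emeasure \<mu> (X - range z) = 0"
    using emeasure_mono[of "X - range z" "- range z" \<mu>] finR null by auto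
  then have "emeasure \<mu> X = emeasure \<mu> (X \<inter> range z)"
    using emeasure_Un_null_set[of "X \<inter> range z" \<mu> "X - range z"] finR
    by (simp add: null_sets_def Int_Diff_Un)
  also have "\<dots> = (\<Sum>u\<in>z ` (z -` X). emeasure \<mu> {u})"
    unfolding R by (rule emeasure_eq_sum_singleton) (auto simp: sets)
  also have "\<dots> = (\<Sum>i\<in>z -` X. ennreal (measure \<mu> {z i}))"
    by (subst sum.reindex)
       (use \<open>inj z\<close> in \<open>auto simp: emeasure_eq_measure intro: inj_on_subset\<close>)
  also have "\<dots> = (\<Sum>i\<in>UNIV. ennreal (measure \<mu> {z i}) * emeasure (return borel (z i)) X)"
    using X by (intro sum.mono_neutral_cong_left) (auto simp: sets)
  also have "\<dots> = emeasure (atomic_measure (\<lambda>i. measure \<mu> {z i}) z) X"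
    using X by (simp add: emeasure_atomic_measure sets)
  finally show "emeasure \<mu> X = emeasure (atomic_measure (\<lambda>i. measure \<mu> {z i}) z) X" .
qed (simp add: sets)

lemma D_KL_atomic_measure:
  assumes p: "\<And>i. 0 \<le> p i" and q: "\<And>i. 0 \<le> q i" "(\<Sum>i\<in>UNIV. q i) = 1"
    and "inj z" and pq: "\<And>i. q i = 0 \<Longrightarrow> p i = 0"
  shows "D_KL (atomic_measure p z) (atomic_measure q z)
           = ereal (\<Sum>i\<in>UNIV. p i * ln (p i / q i))"
proof -
  define P where "P = atomic_measure p z"
  define Q where "Q = atomic_measure q z"
  interpret Q: prob_space Q unfolding Q_def by (rule prob_space_atomic_measure[OF q])
  have setsPQ: "sets P = sets Q" "sets Q = sets borel" by (simp_all add: P_def Q_def)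
  have ac: "absolutely_continuous Q P"
  proof -
    have "N \<in> null_sets P" if "N \<in> null_sets Q" for N
    proof -
      have N: "N \<in> sets borel" "emeasure Q N = 0" using that by (auto simp: setsPQ)
      have "(\<Sum>i\<in>UNIV. q i * indicator N (z i)) \<le> 0"
        using N unfolding Q_def by (simp add: emeasure_atomic_measure_real q ennreal_eq_0_iff)
      moreover have "0 \<le> (\<Sum>i\<in>UNIV. q i * indicator N (z i))"
        by (intro sum_nonneg) (simp add: q)
      ultimately have "(\<Sum>i\<in>UNIV. q i * indicator N (z i)) = 0" by linarith
      then have "\<And>i. q i * indicator N (z i) = 0"
        using q by (subst (asm) sum_nonneg_eq_0_iff) auto
      then have "\<And>i. p i * indicator N (z i) = 0" using pq by (metis mult_eq_0_iff)
      then have "emeasure P N = 0"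
        unfolding P_def using N by (simp only: emeasure_atomic_measure_real p) simp
      then show ?thesis using N by (auto simp: setsPQ)
    qed
    then show ?thesis by (auto simp: absolutely_continuous_def)
  qed
  have ed [measurable]: "entropy_density (exp 1) Q P \<in> borel_measurable borel"
    using measurable_entropy_density[of "exp 1" Q P] by (simp add: measurable_cong_sets[OF setsPQ(2) refl])
  \<comment> \<open>The factor \<open>p i\<close> stays because the Radon-Nikodym derivative is
    determined only at atoms with \<open>q i > 0\<close>. There it is found by integrating over the
    singleton; elsewhere \<open>p i = 0\<close>.\<close>
  have RN: "p i * entropy_density (exp 1) Q P (z i) = p i * ln (p i / q i)" for i
  proof (cases "q i = 0")
    case False
    have "ennreal (p i) = emeasure (density Q (RN_deriv Q P)) {z i}"
      using Q.density_RN_deriv[OF ac] setsPQ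
      by (simp add: P_def emeasure_atomic_measure_singleton p \<open>inj z\<close>)
    also have "\<dots> = (\<integral>\<^sup>+u. RN_deriv Q P u * indicator {z i} u \<partial>Q)"
      by (rule emeasure_density) (simp_all add: setsPQ)
    also have "\<dots> = (\<integral>\<^sup>+u. RN_deriv Q P (z i) * indicator {z i} u \<partial>Q)"
      by (intro nn_integral_cong) (auto simp: indicator_def)
    also have "\<dots> = RN_deriv Q P (z i) * ennreal (q i)"
      by (subst nn_integral_cmult_indicator)
         (simp_all add: setsPQ Q_def emeasure_atomic_measure_singleton q \<open>inj z\<close>)
    finally have "p i = enn2real (RN_deriv Q P (z i)) * q i"
      using p[of i] q(1)[of i] by (metis enn2real_ennreal enn2real_mult)
    then have "enn2real (RN_deriv Q P (z i)) = p i / q i" using False by (simp add: field_simps)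
    then show ?thesis by (simp add: entropy_density_def log_def)
  qed (simp add: pq)
  have "KL_divergence (exp 1) Q P = (\<Sum>i\<in>UNIV. p i * ln (p i / q i))"
    unfolding KL_divergence_def P_def
    by (subst integral_atomic_measure[OF p]) (simp_all add: ed[unfolded P_def] RN[unfolded P_def])
  moreover have "integrable P (entropy_density (exp 1) Q P)"
    unfolding P_def by (rule integrable_atomic_measure) (simp add: ed[unfolded P_def])
  ultimately show ?thesis using ac by (simp add: D_KL_def P_def Q_def)
qed

section \<open>Strict convexity of the entropy\<close>

text \<open>At \<open>0\<close> the convention \<open>0 * ln 0 = 0\<close> agrees with the limit
  from the right.\<close>

lemma continuous_on_mult_ln: "continuous_on {0..} (\<lambda>t::real. t * ln t)"
  unfolding continuous_on_def
proof
  fix t :: real assume t: "t \<in> {0..}"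
  show "((\<lambda>t. t * ln t) \<longlongrightarrow> t * ln t) (at t within {0..})"
  proof (cases "t = 0")
    case True
    have "((\<lambda>t::real. t * ln t) \<longlongrightarrow> 0) (at_right 0)" by real_asymp
    then show ?thesis using True by (simp add: at_within_Ici_at_right)
  next
    case False
    then show ?thesis using t by (intro tendsto_intros) auto
  qed
qed

text \<open>The left side is the tangent of \<open>t * ln t\<close> at \<open>m\<close>, evaluated
  at \<open>s\<close>. For \<open>s > 0\<close> the bound is \<open>ln t \<le> t - 1\<close> at
  \<open>t = m / s\<close>, with equality only for \<open>t = 1\<close>.\<close>

lemma tangent_mult_ln:
  fixes s m :: real
  assumes "0 \<le> s" "0 < m"
  shows "s * ln m + (s - m) \<le> s * ln s"
    and "s \<noteq> m \<Longrightarrow> s * ln m + (s - m) < s * ln s"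
proof -
  have *: "s * ln m - s * ln s = s * ln (m / s)" "s * (m / s - 1) = m - s" if "s > 0"
    using that assms by (simp_all add: ln_div field_simps)
  show "s * ln m + (s - m) \<le> s * ln s"
  proof (cases "s = 0")
    case False
    then show ?thesis
      using * assms mult_left_mono[OF ln_le_minus_one[of "m / s"], of s] by simp
  qed (use assms in simp)
  assume "s \<noteq> m"
  show "s * ln m + (s - m) < s * ln s"
  proof (cases "s = 0")
    case False
    then have "ln (m / s) \<noteq> m / s - 1"
      using ln_eq_minus_one[of "m / s"] \<open>s \<noteq> m\<close> assms by auto
    then have "ln (m / s) < m / s - 1"
      using ln_le_minus_one[of "m / s"] False assms by simp
    then have "s * ln (m / s) < s * (m / s - 1)" using False assms by simp
    then show ?thesis using * False assms by simp
  qed (use assms in simp)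
qed

text \<open>The tangents at the midpoint, evaluated at \<open>s\<close> and \<open>t\<close>, have
  linear corrections that cancel.\<close>

lemma midpoint_mult_ln:
  fixes s t :: real
  assumes "0 \<le> s" "0 \<le> t"
  shows "2 * ((s + t) / 2 * ln ((s + t) / 2)) \<le> s * ln s + t * ln t"
    and "s \<noteq> t \<Longrightarrow> 2 * ((s + t) / 2 * ln ((s + t) / 2)) < s * ln s + t * ln t"
proof -
  define m where "m = (s + t) / 2"
  have m: "2 * (m * ln m) = (s * ln m + (s - m)) + (t * ln m + (t - m))"
    by (simp add: m_def field_simps)
  show "2 * ((s + t) / 2 * ln ((s + t) / 2)) \<le> s * ln s + t * ln t"
  proof (cases "m > 0")
    case True
    then show ?thesis
      using m tangent_mult_ln(1)[OF assms(1) True] tangent_mult_ln(1)[OF assms(2) True]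
      unfolding m_def[symmetric] by linarith
  next
    case False
    then have "s = 0" "t = 0" using assms by (auto simp: m_def)
    then show ?thesis by simp
  qed
  assume "s \<noteq> t"
  then have "m > 0" "s \<noteq> m" using assms by (auto simp: m_def)
  then show "2 * ((s + t) / 2 * ln ((s + t) / 2)) < s * ln s + t * ln t"
    using m tangent_mult_ln(2)[OF assms(1), of m] tangent_mult_ln(1)[OF assms(2), of m]
    unfolding m_def[symmetric] by linarith
qed

section \<open>Entropic transport between finitely supported measures\<close>

lemma inner_outer: "A \<bullet> outer u v = u \<bullet> (A *v v)"
  by (simp add: outer_def inner_vec_def matrix_vector_mult_def sum_distrib_left sum_distrib_right mult_ac)

lemma norm_outer: "norm (outer u v) = norm u * norm v"
proof -
  have "(norm (outer u v))\<^sup>2 = (norm u * norm v)\<^sup>2"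
    unfolding power2_norm_eq_inner power_mult_distrib
    by (simp add: outer_def inner_vec_def sum_product mult_ac) (rule sum.swap)
  then show ?thesis by (simp add: power2_eq_iff_nonneg)
qed

lemma cost_eq_inner: "cost A (u, v) = - 4 * (norm u)\<^sup>2 * (norm v)\<^sup>2 - 32 * (A \<bullet> outer u v)"
  by (simp add: cost_def inner_outer)

lemma borel_measurable_cost: "cost A \<in> borel_measurable borel"
proof -
  have "continuous_on UNIV (\<lambda>z. - 4 * (norm (fst z))\<^sup>2 * (norm (snd z))\<^sup>2 - 32 * (fst z \<bullet> (A *v snd z)))"
    by (intro continuous_intros continuous_on_compose2[OF linear_continuous_on[OF matrix_vector_mul_bounded_linear]])
       auto
  then show ?thesis
    by (simp add: cost_def case_prod_unfold borel_measurable_continuous_onI)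
qed

section \<open>Couplings as matrices with prescribed row and column sums\<close>

locale discrete_transport =
  fixes a :: "'n0::finite \<Rightarrow> real" and b :: "'n1::finite \<Rightarrow> real"
    and x :: "'n0 \<Rightarrow> real^'d0::finite" and y :: "'n1 \<Rightarrow> real^'d1::finite" and \<epsilon> :: real
  assumes a_nonneg: "\<And>i. 0 \<le> a i" and a_sum: "(\<Sum>i\<in>UNIV. a i) = 1" and inj_x: "inj x"
    and b_nonneg: "\<And>j. 0 \<le> b j" and b_sum: "(\<Sum>j\<in>UNIV. b j) = 1" and inj_y: "inj y"
    and eps: "\<epsilon> > 0"
begin

abbreviation \<mu>0 where "\<mu>0 \<equiv> atomic_measure a x"
abbreviation \<mu>1 where "\<mu>1 \<equiv> atomic_measure b y"

definition xy :: "'n0 \<times> 'n1 \<Rightarrow> (real^'d0) \<times> (real^'d1)" where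
  "xy = (\<lambda>(i, j). (x i, y j))"

lemma inj_xy: "inj xy"
  using inj_x inj_y by (auto simp: xy_def inj_def)

definition plans :: "(real^'n1^'n0) set" where
  "plans = {P. (\<forall>i j. 0 \<le> P $ i $ j) \<and> (\<forall>i. (\<Sum>j\<in>UNIV. P $ i $ j) = a i)
             \<and> (\<forall>j. (\<Sum>i\<in>UNIV. P $ i $ j) = b j)}"

definition plan_measure :: "real^'n1^'n0 \<Rightarrow> ((real^'d0) \<times> (real^'d1)) measure" where
  "plan_measure P = atomic_measure (\<lambda>(i, j). P $ i $ j) xy"

lemma sum_pairs: "(\<Sum>ij\<in>UNIV. f ij) = (\<Sum>i\<in>UNIV. \<Sum>j\<in>UNIV. f (i::'n0, j::'n1))"
  by (simp add: sum.cartesian_product flip: UNIV_Times_UNIV)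

lemma sets_product: "sets (\<mu>0 \<Otimes>\<^sub>M \<mu>1) = sets borel"
  by (rule trans[OF sets_pair_measure_cong arg_cong[where f=sets, OF borel_prod]]) simp_all

lemma product_eq_atomic_measure: "\<mu>0 \<Otimes>\<^sub>M \<mu>1 = atomic_measure (\<lambda>(i, j). a i * b j) xy"
proof (rule pair_measure_eqI)
  show "sigma_finite_measure \<mu>0" "sigma_finite_measure \<mu>1"
    using prob_space_atomic_measure a_nonneg a_sum b_nonneg b_sum
    by (metis finite_measure.sigma_finite_measure prob_space.finite_measure)+
  show "sets (\<mu>0 \<Otimes>\<^sub>M \<mu>1) = sets (atomic_measure (\<lambda>(i, j). a i * b j) xy)"
    by (simp only: sets_product sets_atomic_measure)
  fix X Y assume X: "X \<in> sets \<mu>0" and Y: "Y \<in> sets \<mu>1"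
  have XY: "X \<times> Y \<in> sets borel"
    using X Y by (simp add: borel_Times)
  have "emeasure \<mu>0 X * emeasure \<mu>1 Y
      = ennreal ((\<Sum>i\<in>UNIV. a i * indicator X (x i)) * (\<Sum>j\<in>UNIV. b j * indicator Y (y j)))"
    using X Y by (simp only: emeasure_atomic_measure_real a_nonneg b_nonneg sets_atomic_measure)
      (simp add: ennreal_mult sum_nonneg a_nonneg b_nonneg)
  also have "(\<Sum>i\<in>UNIV. a i * indicator X (x i)) * (\<Sum>j\<in>UNIV. b j * indicator Y (y j))
      = (\<Sum>ij\<in>UNIV. (case ij of (i, j) \<Rightarrow> a i * b j) * indicator (X \<times> Y) (xy ij))"
    unfolding sum_product sum_pairs by (intro sum.cong) (auto simp: xy_def indicator_def)
  also have "ennreal \<dots> = emeasure (atomic_measure (\<lambda>(i, j). a i * b j) xy) (X \<times> Y)"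
    by (rule emeasure_atomic_measure_real[symmetric]) (auto simp: XY a_nonneg b_nonneg)
  finally show "emeasure \<mu>0 X * emeasure \<mu>1 Y
      = emeasure (atomic_measure (\<lambda>(i, j). a i * b j) xy) (X \<times> Y)" .
qed

lemma plan_measure_in_couplings:
  assumes P: "P \<in> plans"
  shows "plan_measure P \<in> couplings \<mu>0 \<mu>1"
proof -
  have nn: "\<And>ij. 0 \<le> (case ij of (i, j) \<Rightarrow> P $ i $ j)" using P by (auto simp: plans_def)
  have sets: "sets (plan_measure P) = sets (\<mu>0 \<Otimes>\<^sub>M \<mu>1)"
    by (simp only: sets_product sets_atomic_measure plan_measure_def)
  have m: "fst \<in> measurable (plan_measure P) \<mu>0" "snd \<in> measurable (plan_measure P) \<mu>1"
    unfolding measurable_cong_sets[OF sets refl] by (rule measurable_fst, rule measurable_snd)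
  have "distr (plan_measure P) \<mu>0 fst = \<mu>0"
  proof (rule measure_eqI)
    fix X assume "X \<in> sets (distr (plan_measure P) \<mu>0 fst)"
    then have X: "X \<in> sets borel" by simp
    have X': "X \<times> (UNIV :: (real^'d1) set) \<in> sets borel"
      using X by (simp add: borel_Times)
    have "emeasure (distr (plan_measure P) \<mu>0 fst) X = emeasure (plan_measure P) (X \<times> UNIV)"
      using X by (subst emeasure_distr[OF m(1)]) (auto simp: plan_measure_def intro!: arg_cong[where f="emeasure _"])
    also have "\<dots> = ennreal (\<Sum>ij\<in>UNIV. (case ij of (i, j) \<Rightarrow> P $ i $ j) * indicator (X \<times> UNIV) (xy ij))"
      unfolding plan_measure_def by (rule emeasure_atomic_measure_real[OF nn X'])
    also have "(\<Sum>ij\<in>UNIV. (case ij of (i, j) \<Rightarrow> P $ i $ j) * indicator (X \<times> UNIV) (xy ij))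
        = (\<Sum>i\<in>UNIV. a i * indicator X (x i))"
      unfolding sum_pairs using P
      by (intro sum.cong) (auto simp: xy_def plans_def indicator_def)
    also have "ennreal \<dots> = emeasure \<mu>0 X"
      by (rule emeasure_atomic_measure_real[OF a_nonneg X, symmetric])
    finally show "emeasure (distr (plan_measure P) \<mu>0 fst) X = emeasure \<mu>0 X" .
  qed simp
  moreover have "distr (plan_measure P) \<mu>1 snd = \<mu>1"
  proof (rule measure_eqI)
    fix X assume "X \<in> sets (distr (plan_measure P) \<mu>1 snd)"
    then have X: "X \<in> sets borel" by simp
    have X': "(UNIV :: (real^'d0) set) \<times> X \<in> sets borel"
      using X by (simp add: borel_Times)
    have "emeasure (distr (plan_measure P) \<mu>1 snd) X = emeasure (plan_measure P) (UNIV \<times> X)"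
      using X by (subst emeasure_distr[OF m(2)]) (auto simp: plan_measure_def intro!: arg_cong[where f="emeasure _"])
    also have "\<dots> = ennreal (\<Sum>ij\<in>UNIV. (case ij of (i, j) \<Rightarrow> P $ i $ j) * indicator (UNIV \<times> X) (xy ij))"
      unfolding plan_measure_def by (rule emeasure_atomic_measure_real[OF nn X'])
    also have "(\<Sum>ij\<in>UNIV. (case ij of (i, j) \<Rightarrow> P $ i $ j) * indicator (UNIV \<times> X) (xy ij))
        = (\<Sum>j\<in>UNIV. b j * indicator X (y j))"
      unfolding sum_pairs using P
      by (subst sum.swap, intro sum.cong) (auto simp: xy_def plans_def indicator_def)
    also have "ennreal \<dots> = emeasure \<mu>1 X"
      by (rule emeasure_atomic_measure_real[OF b_nonneg X, symmetric])
    finally show "emeasure (distr (plan_measure P) \<mu>1 snd) X = emeasure \<mu>1 X" .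
  qed simp
  ultimately show ?thesis using sets by (simp add: couplings_def)
qed

text \<open>The marginals give no mass off the supports, so the complement of the grid is a union of
  two null strips and the coupling is atomic. Together with \<open>plan_measure_in_couplings\<close>
  this makes the transport problem finite-dimensional.\<close>

lemma coupling_eq_plan_measure:
  assumes pi: "\<pi> \<in> couplings \<mu>0 \<mu>1"
  shows "\<exists>P\<in>plans. \<pi> = plan_measure P"
proof -
  have sets: "sets \<pi> = sets (\<mu>0 \<Otimes>\<^sub>M \<mu>1)"
    and d: "distr \<pi> \<mu>0 fst = \<mu>0" "distr \<pi> \<mu>1 snd = \<mu>1"
    using pi unfolding couplings_def by blast+
  have sets': "sets \<pi> = sets borel" using sets sets_product by (rule trans)
  have space: "space \<pi> = UNIV" using sets_eq_imp_space_eq[OF sets'] by simp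
  have m: "fst \<in> measurable \<pi> \<mu>0" "snd \<in> measurable \<pi> \<mu>1"
    unfolding measurable_cong_sets[OF sets refl] by (rule measurable_fst, rule measurable_snd)
  have fst: "emeasure \<pi> (X \<times> UNIV) = emeasure \<mu>0 X" if "X \<in> sets borel" for X
  proof -
    have "emeasure (distr \<pi> \<mu>0 fst) X = emeasure \<pi> (X \<times> UNIV)"
      using that by (subst emeasure_distr[OF m(1)]) (auto simp: space intro!: arg_cong[where f="emeasure _"])
    then show ?thesis by (simp only: d)
  qed
  have snd: "emeasure \<pi> (UNIV \<times> Y) = emeasure \<mu>1 Y" if "Y \<in> sets borel" for Y
  proof -
    have "emeasure (distr \<pi> \<mu>1 snd) Y = emeasure \<pi> (UNIV \<times> Y)"
      using that by (subst emeasure_distr[OF m(2)]) (auto simp: space intro!: arg_cong[where f="emeasure _"])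
    then show ?thesis by (simp only: d)
  qed
  have rect: "X \<times> Y \<in> sets \<pi>" if "X \<in> sets borel" "Y \<in> sets borel" for X Y
    using borel_Times[OF that] unfolding sets' .
  have "emeasure \<pi> UNIV = 1"
    using fst[of UNIV] by (simp add: emeasure_atomic_measure_real a_nonneg a_sum)
  then interpret prob_space \<pi> by (intro prob_spaceI) (simp add: space)
  have rx: "- range x \<in> sets borel" "- range y \<in> sets borel"
    by (intro borel_comp borel_closed finite_imp_closed finite_imageI finite)+
  have "emeasure \<pi> ((- range x) \<times> UNIV) = 0" "emeasure \<pi> (UNIV \<times> (- range y)) = 0"
    using rx by (auto simp: fst snd emeasure_atomic_measure_real a_nonneg b_nonneg)
  then have "(- range x) \<times> UNIV \<union> UNIV \<times> (- range y) \<in> null_sets \<pi>"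
    using rx rect by (intro null_sets.Un) (auto simp: null_sets_def)
  moreover have "- range xy = (- range x) \<times> UNIV \<union> UNIV \<times> (- range y)"
    by (auto simp: xy_def image_iff)
  ultimately have null: "emeasure \<pi> (- range xy) = 0" by (simp add: null_sets_def)
  define P where "P = (\<chi> i j. measure \<pi> {(x i, y j)})"
  have eq: "\<pi> = plan_measure P"
    unfolding plan_measure_def
    by (subst eq_atomic_measureI[OF finite_measure sets' null inj_xy])
       (simp add: P_def xy_def case_prod_unfold)
  have nn: "\<And>ij. 0 \<le> (case ij of (i, j) \<Rightarrow> P $ i $ j)" by (auto simp: P_def)
  have emP: "emeasure \<pi> Z = ennreal (\<Sum>i\<in>UNIV. \<Sum>j\<in>UNIV. P $ i $ j * indicator Z (x i, y j))"
    if "Z \<in> sets borel" for Z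
    by (subst eq, unfold plan_measure_def, subst emeasure_atomic_measure_real[OF nn that])
       (simp add: sum_pairs xy_def)
  have rows: "(\<Sum>j\<in>UNIV. P $ i $ j) = a i" for i
  proof -
    have "ennreal (a i) = emeasure \<pi> ({x i} \<times> UNIV)"
      by (simp add: fst emeasure_atomic_measure_singleton a_nonneg inj_x)
    also have "\<dots> = ennreal (\<Sum>k\<in>UNIV. \<Sum>j\<in>UNIV. P $ k $ j * indicator ({x i} \<times> UNIV) (x k, y j))"
      by (rule emP) (use rect[of "{x i}" UNIV] sets' in simp)
    also have "(\<Sum>k\<in>UNIV. \<Sum>j\<in>UNIV. P $ k $ j * indicator ({x i} \<times> UNIV) (x k, y j))
        = (\<Sum>k\<in>UNIV. if k = i then \<Sum>j\<in>UNIV. P $ k $ j else 0)"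
      using inj_x by (intro sum.cong) (auto simp: indicator_def inj_eq)
    finally show ?thesis by (simp add: a_nonneg P_def sum_nonneg)
  qed
  have cols: "(\<Sum>i\<in>UNIV. P $ i $ j) = b j" for j
  proof -
    have "ennreal (b j) = emeasure \<pi> (UNIV \<times> {y j})"
      by (simp add: snd emeasure_atomic_measure_singleton b_nonneg inj_y)
    also have "\<dots> = ennreal (\<Sum>i\<in>UNIV. \<Sum>k\<in>UNIV. P $ i $ k * indicator (UNIV \<times> {y j}) (x i, y k))"
      by (rule emP) (use rect[of UNIV "{y j}"] sets' in simp)
    also have "(\<Sum>i\<in>UNIV. \<Sum>k\<in>UNIV. P $ i $ k * indicator (UNIV \<times> {y j}) (x i, y k))
        = (\<Sum>k\<in>UNIV. if k = j then \<Sum>i\<in>UNIV. P $ i $ k else 0)"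
      using inj_y by (subst sum.swap, intro sum.cong) (auto simp: indicator_def inj_eq)
    finally show ?thesis by (simp add: b_nonneg P_def sum_nonneg)
  qed
  have "P \<in> plans" using nn rows cols by (auto simp: plans_def)
  then show ?thesis using eq by blast
qed

text \<open>The divergence is split into a linear part and \<open>\<Sum> P ln P\<close>. Since \<open>ln 0 = 0\<close> and plans vanish
  where \<open>a i * b j = 0\<close>, atoms of mass zero cause no exception.\<close>

definition J :: "real^'d1^'d0 \<Rightarrow> real^'n1^'n0 \<Rightarrow> real" where
  "J A P = (\<Sum>i\<in>UNIV. \<Sum>j\<in>UNIV. P $ i $ j * (cost A (x i, y j) - \<epsilon> * ln (a i * b j))
              + \<epsilon> * (P $ i $ j * ln (P $ i $ j)))"

text \<open>Forces entries to vanish where \<open>a i * b j = 0\<close>, that is, absolute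
  continuity with respect to the product measure.\<close>

lemma plans_entry_le:
  assumes "P \<in> plans"
  shows "P $ i $ j \<le> a i" "P $ i $ j \<le> b j"
proof -
  have "P $ i $ j \<le> (\<Sum>j\<in>UNIV. P $ i $ j)" "P $ i $ j \<le> (\<Sum>i\<in>UNIV. P $ i $ j)"
    using assms member_le_sum[of j UNIV "\<lambda>j. P $ i $ j"] member_le_sum[of i UNIV "\<lambda>i. P $ i $ j"]
    by (simp_all add: plans_def)
  then show "P $ i $ j \<le> a i" "P $ i $ j \<le> b j" using assms by (auto simp: plans_def)
qed

lemma OT_objective_plan_measure:
  assumes P: "P \<in> plans"
  shows "OT_objective \<epsilon> \<mu>0 \<mu>1 A (plan_measure P) = ereal (J A P)"
proof -
  have nn: "\<And>ij. 0 \<le> (case ij of (i, j) \<Rightarrow> P $ i $ j)" using P by (auto simp: plans_def)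
  have zero: "P $ i $ j = 0" if "a i * b j = 0" for i j
    using that plans_entry_le[OF P, of i j] P by (auto simp: plans_def intro: antisym)
  have "(\<integral>z. cost A z \<partial>plan_measure P) = (\<Sum>i\<in>UNIV. \<Sum>j\<in>UNIV. P $ i $ j * cost A (x i, y j))"
    unfolding plan_measure_def
    by (subst integral_atomic_measure[OF nn borel_measurable_cost]) (simp add: sum_pairs xy_def)
  moreover have "D_KL (plan_measure P) (\<mu>0 \<Otimes>\<^sub>M \<mu>1)
      = ereal (\<Sum>i\<in>UNIV. \<Sum>j\<in>UNIV. P $ i $ j * ln (P $ i $ j / (a i * b j)))"
    unfolding plan_measure_def product_eq_atomic_measure
    by (subst D_KL_atomic_measure[OF nn _ _ inj_xy])
       (auto simp: sum_pairs a_nonneg b_nonneg a_sum b_sum zero simp flip: sum_product)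
  moreover have "P $ i $ j * ln (P $ i $ j / (a i * b j))
      = P $ i $ j * ln (P $ i $ j) - P $ i $ j * ln (a i * b j)" for i j
  proof (cases "P $ i $ j = 0")
    case False
    then have "P $ i $ j > 0" "a i * b j > 0"
      using nn[of "(i, j)"] zero[of i j] a_nonneg[of i] b_nonneg[of j]
      by (auto simp: less_le)
    then show ?thesis by (auto simp add: ln_div right_diff_distrib)
  qed simp
  ultimately show ?thesis
    by (simp add: OT_objective_def J_def sum_subtractf sum.distrib sum_distrib_left algebra_simps)
qed

section \<open>Existence and uniqueness of the optimal plan\<close>

lemma compact_plans: "compact plans"
proof -
  have "norm P \<le> 1" if P: "P \<in> plans" for P
  proof -
    have "norm P \<le> (\<Sum>i\<in>UNIV. norm (P $ i))"
      unfolding norm_vec_def by (rule L2_set_le_sum) simp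
    also have "\<dots> \<le> (\<Sum>i\<in>UNIV. \<Sum>j\<in>UNIV. \<bar>P $ i $ j\<bar>)"
      by (intro sum_mono norm_le_l1_cart)
    also have "\<dots> = (\<Sum>i\<in>UNIV. \<Sum>j\<in>UNIV. P $ i $ j)"
      using P by (intro sum.cong refl) (auto simp: plans_def)
    also have "\<dots> = 1" using P a_sum by (simp add: plans_def)
    finally show ?thesis .
  qed
  then have "bounded plans" by (auto simp: bounded_iff)
  moreover have "closed plans"
    unfolding plans_def
    by (intro closed_Collect_conj closed_Collect_all closed_Collect_le closed_Collect_eq continuous_intros)
  ultimately show ?thesis by (simp add: compact_eq_bounded_closed)
qed

lemma continuous_on_J: "continuous_on plans (J A)"
  unfolding J_def
  by (intro continuous_intros continuous_on_compose2[OF continuous_on_mult_ln]) (auto simp: plans_def)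

lemma product_plan_in_plans: "(\<chi> i j. a i * b j) \<in> plans"
  using a_sum b_sum
  by (simp add: plans_def a_nonneg b_nonneg flip: sum_distrib_left sum_distrib_right)

text \<open>The linear part of \<open>J\<close> averages exactly, and each entropy term is midpoint
  convex, strictly so at an entry where the plans differ.\<close>

lemma
  assumes P: "P \<in> plans" and R: "R \<in> plans" and "P \<noteq> R"
  shows midpoint_in_plans: "(1/2) *\<^sub>R (P + R) \<in> plans"
    and J_midpoint_less: "2 * J A ((1/2) *\<^sub>R (P + R)) < J A P + J A R"
proof -
  show "(1/2) *\<^sub>R (P + R) \<in> plans"
    using P R by (simp add: plans_def sum.distrib flip: sum_divide_distrib)
  define d where "d i j = cost A (x i, y j) - \<epsilon> * ln (a i * b j)" for i j
  define s where "s i j = (P $ i $ j + R $ i $ j) / 2" for i j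
  define l where "l i j = 2 * (s i j * d i j + \<epsilon> * (s i j * ln (s i j)))" for i j
  define r where "r i j = P $ i $ j * d i j + \<epsilon> * (P $ i $ j * ln (P $ i $ j))
      + (R $ i $ j * d i j + \<epsilon> * (R $ i $ j * ln (R $ i $ j)))" for i j
  have lr: "l i j = (P $ i $ j + R $ i $ j) * d i j + \<epsilon> * (2 * (s i j * ln (s i j)))"
     "r i j = (P $ i $ j + R $ i $ j) * d i j
        + \<epsilon> * (P $ i $ j * ln (P $ i $ j) + R $ i $ j * ln (R $ i $ j))" for i j
    by (simp_all add: l_def r_def s_def algebra_simps)
  have nn: "0 \<le> P $ i $ j" "0 \<le> R $ i $ j" for i j using P R by (auto simp: plans_def)
  have le: "l i j \<le> r i j" for i j
    unfolding lr using midpoint_mult_ln(1)[OF nn, of i j i j] eps by (simp add: s_def)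
  obtain i j where "P $ i $ j \<noteq> R $ i $ j" using \<open>P \<noteq> R\<close> by (auto simp: vec_eq_iff)
  then have "l i j < r i j"
    unfolding lr using midpoint_mult_ln(2)[OF nn, of i j i j] eps by (simp add: s_def)
  then have "(\<Sum>j\<in>UNIV. l i j) < (\<Sum>j\<in>UNIV. r i j)"
    using le by (intro sum_strict_mono_ex1) auto
  then have "(\<Sum>i\<in>UNIV. \<Sum>j\<in>UNIV. l i j) < (\<Sum>i\<in>UNIV. \<Sum>j\<in>UNIV. r i j)"
    using le by (intro sum_strict_mono_ex1) (auto intro: sum_mono)
  moreover have "(\<Sum>i\<in>UNIV. \<Sum>j\<in>UNIV. l i j) = 2 * J A ((1/2) *\<^sub>R (P + R))"
    by (simp add: l_def J_def s_def d_def sum_distrib_left)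
  moreover have "(\<Sum>i\<in>UNIV. \<Sum>j\<in>UNIV. r i j) = J A P + J A R"
    by (simp add: r_def J_def d_def sum.distrib)
  ultimately show "2 * J A ((1/2) *\<^sub>R (P + R)) < J A P + J A R" by simp
qed

abbreviation plan :: "real^'d1^'d0 \<Rightarrow> real^'n1^'n0" where
  "plan \<equiv> opt_plan \<epsilon> \<mu>0 \<mu>1 x y"

lemma OT_le: "P \<in> plans \<Longrightarrow> OT \<epsilon> \<mu>0 \<mu>1 A \<le> ereal (J A P)"
  unfolding OT_def OT_objective_plan_measure[symmetric] by (rule INF_lower[OF plan_measure_in_couplings])

text \<open>Compactness yields a minimiser of \<open>J\<close>. The midpoint with a second minimiser
  would be strictly better, so the description in \<open>opt_coupling\<close> has a unique
  solution.\<close>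

lemma plan_optimal:
  shows plan_in_plans: "plan A \<in> plans" and OT_eq: "OT \<epsilon> \<mu>0 \<mu>1 A = ereal (J A (plan A))"
proof -
  obtain P where P: "P \<in> plans" and min: "\<And>R. R \<in> plans \<Longrightarrow> J A P \<le> J A R"
    using continuous_attains_inf[OF compact_plans _ continuous_on_J] product_plan_in_plans by blast
  have OT: "OT \<epsilon> \<mu>0 \<mu>1 A = ereal (J A P)"
  proof (rule antisym[OF OT_le[OF P]])
    show "ereal (J A P) \<le> OT \<epsilon> \<mu>0 \<mu>1 A"
      unfolding OT_def
    proof (rule INF_greatest)
      fix \<pi> assume "\<pi> \<in> couplings \<mu>0 \<mu>1"
      then obtain R where "R \<in> plans" "\<pi> = plan_measure R" using coupling_eq_plan_measure by blast
      then show "ereal (J A P) \<le> OT_objective \<epsilon> \<mu>0 \<mu>1 A \<pi>"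
        using min by (simp add: OT_objective_plan_measure)
    qed
  qed
  have "opt_coupling \<epsilon> \<mu>0 \<mu>1 A = plan_measure P"
    unfolding opt_coupling_def
  proof (rule the_equality)
    show "plan_measure P \<in> couplings \<mu>0 \<mu>1 \<and> OT_objective \<epsilon> \<mu>0 \<mu>1 A (plan_measure P) = OT \<epsilon> \<mu>0 \<mu>1 A"
      using P by (simp add: plan_measure_in_couplings OT_objective_plan_measure OT)
    fix \<pi> assume \<pi>: "\<pi> \<in> couplings \<mu>0 \<mu>1 \<and> OT_objective \<epsilon> \<mu>0 \<mu>1 A \<pi> = OT \<epsilon> \<mu>0 \<mu>1 A"
    then obtain R where R: "R \<in> plans" "\<pi> = plan_measure R" using coupling_eq_plan_measure by blast
    then have "J A R = J A P" using \<pi> by (simp add: OT_objective_plan_measure OT)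
    then have "R = P"
      using midpoint_in_plans[OF R(1) P] J_midpoint_less[OF R(1) P, of A] min by fastforce
    then show "\<pi> = plan_measure P" using R by simp
  qed
  moreover have "measure (plan_measure P) {(x i, y j)} = P $ i $ j" for i j
    using measure_atomic_measure_singleton[of "\<lambda>(i, j). P $ i $ j" xy "(i, j)"] P inj_xy
    by (auto simp: plan_measure_def plans_def xy_def)
  ultimately have "plan A = P" by (simp add: opt_plan_def vec_eq_iff)
  then show "plan A \<in> plans" "OT \<epsilon> \<mu>0 \<mu>1 A = ereal (J A (plan A))" using P OT by simp_all
qed

section \<open>Gradient and minimisers of the objective\<close>

definition barycenter :: "real^'n1^'n0 \<Rightarrow> real^'d1^'d0" where
  "barycenter P = (\<Sum>i\<in>UNIV. \<Sum>j\<in>UNIV. P $ i $ j *\<^sub>R outer (x i) (y j))"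

text \<open>The entropy does not involve the matrix and the cost is affine in it; its slope is
  governed by \<open>barycenter P\<close>, the uncentred cross-moment matrix of the plan.\<close>

lemma J_change_matrix: "J A' P = J A P - 32 * (barycenter P \<bullet> (A' - A))"
proof -
  have "J A' P - J A P = (\<Sum>i\<in>UNIV. \<Sum>j\<in>UNIV. - 32 * (P $ i $ j * (outer (x i) (y j) \<bullet> (A' - A))))"
    unfolding J_def sum_subtractf[symmetric]
    by (intro sum.cong refl) (simp add: cost_eq_inner inner_diff_right inner_commute algebra_simps)
  also have "\<dots> = - 32 * (barycenter P \<bullet> (A' - A))"
    by (simp add: barycenter_def inner_sum_left sum_distrib_left)
  finally show ?thesis by simp
qed

abbreviation \<Phi> :: "real^'d1^'d0 \<Rightarrow> real" where "\<Phi> \<equiv> Phi \<epsilon> \<mu>0 \<mu>1"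

text \<open>Envelope formula: the objective is differentiated with the optimal plan frozen.
  \<open>GDERIV_eq_of_upper_bound\<close> later identifies it with the gradient on the ball.\<close>

definition grad :: "real^'d1^'d0 \<Rightarrow> real^'d1^'d0" where
  "grad A = 64 *\<^sub>R A - 32 *\<^sub>R barycenter (plan A)"

text \<open>Since the optimal plan for \<open>A\<close> is admissible for \<open>A'\<close>, the transport term is a minimum of
  affine functions of the matrix, and only \<open>32 \<parallel>A\<parallel>\<^sup>2\<close> has positive curvature.\<close>

lemma Phi_upper: "\<Phi> A' \<le> \<Phi> A + grad A \<bullet> (A' - A) + 32 * (norm (A' - A))\<^sup>2"
proof -
  have "ereal (J A' (plan A')) \<le> ereal (J A' (plan A))"
    using OT_le[where A=A', OF plan_in_plans[of A]] unfolding OT_eq .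
  then have "J A' (plan A') \<le> J A (plan A) - 32 * (barycenter (plan A) \<bullet> (A' - A))"
    using J_change_matrix[of A' "plan A" A] by simp
  moreover have "32 * (norm A')\<^sup>2 = 32 * (norm A)\<^sup>2 + 64 * (A \<bullet> (A' - A)) + 32 * (norm (A' - A))\<^sup>2"
    unfolding power2_norm_eq_inner by (simp add: inner_diff_left inner_diff_right inner_commute)
  ultimately show ?thesis
    by (simp add: Phi_def OT_eq grad_def inner_diff_left)
qed

text \<open>Each entry of \<open>P\<close> is split into two square roots for Cauchy-Schwarz; row
  and column sums turn the factors into second moments.\<close>

lemma norm_barycenter_le:
  assumes P: "P \<in> plans"
  shows "norm (barycenter P) \<le> M_prod \<mu>0 \<mu>1"
proof -
  have nn: "0 \<le> P $ i $ j" for i j using P by (auto simp: plans_def)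
  have moments: "moment 2 \<mu>0 = (\<Sum>i\<in>UNIV. a i * (norm (x i))\<^sup>2)"
    "moment 2 \<mu>1 = (\<Sum>j\<in>UNIV. b j * (norm (y j))\<^sup>2)"
    unfolding moment_def by (simp_all add: integral_atomic_measure a_nonneg b_nonneg)
  define u where "u = (\<lambda>(i, j). sqrt (P $ i $ j) * norm (x i))"
  define v where "v = (\<lambda>(i, j). sqrt (P $ i $ j) * norm (y j))"
  have "norm (barycenter P) \<le> (\<Sum>i\<in>UNIV. \<Sum>j\<in>UNIV. norm (P $ i $ j *\<^sub>R outer (x i) (y j)))"
    unfolding barycenter_def by (intro order_trans[OF norm_sum] sum_mono norm_sum)
  also have "\<dots> = (\<Sum>ij\<in>UNIV. \<bar>u ij\<bar> * \<bar>v ij\<bar>)"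
    unfolding sum_pairs by (simp add: u_def v_def norm_outer nn abs_mult mult_ac)
  also have "\<dots> \<le> L2_set u UNIV * L2_set v UNIV"
    by (rule L2_set_mult_ineq)
  also have "L2_set u UNIV = sqrt (moment 2 \<mu>0)"
    unfolding moments L2_set_def sum_pairs using P
    by (simp add: u_def power_mult_distrib nn plans_def flip: sum_distrib_right)
  also have "L2_set v UNIV = sqrt (moment 2 \<mu>1)"
    unfolding moments L2_set_def sum_pairs using P
    by (subst sum.swap) (simp add: v_def power_mult_distrib nn plans_def flip: sum_distrib_right)
  finally show ?thesis by (simp add: M_prod_def real_sqrt_mult)
qed

text \<open>The step \<open>1/64\<close> minimises the quadratic in \<open>Phi_upper\<close>, so a
  nonzero \<open>grad Bs\<close> would lower the objective by at least
  \<open>(norm (grad Bs))\<^sup>2 / 128\<close>. Once it vanishes, \<open>Bs\<close> is half a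
  cross-moment matrix.\<close>

lemma minimizer:
  assumes "\<And>A. \<Phi> Bs \<le> \<Phi> A"
  shows grad_minimizer: "grad Bs = 0" and norm_minimizer_le: "norm Bs \<le> M_prod \<mu>0 \<mu>1 / 2"
proof -
  define A where "A = Bs - (1/64) *\<^sub>R grad Bs"
  have "0 \<le> grad Bs \<bullet> (A - Bs) + 32 * (norm (A - Bs))\<^sup>2"
    using assms[of A] Phi_upper[of A Bs] by simp
  also have "\<dots> = - (norm (grad Bs))\<^sup>2 / 128"
    by (simp add: A_def power_divide power2_norm_eq_inner)
  finally show g: "grad Bs = 0" by simp
  then have "2 *\<^sub>R (32 *\<^sub>R Bs) = 32 *\<^sub>R barycenter (plan Bs)" by (simp add: grad_def)
  then have "norm (64 *\<^sub>R Bs) = norm (32 *\<^sub>R barycenter (plan Bs))" by simp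
  then show "norm Bs \<le> M_prod \<mu>0 \<mu>1 / 2"
    using norm_barycenter_le[OF plan_in_plans, of Bs] by simp
qed

lemma approx_grad_error:
  assumes "delta_oracle \<delta> (Pt A) (plan A)"
  shows "norm (approx_grad x y Pt A - grad A)
           \<le> 32 * \<delta> * (\<Sum>i\<in>UNIV. \<Sum>j\<in>UNIV. norm (x i) * norm (y j))"
proof -
  have entry: "\<bar>Pt A $ i $ j - plan A $ i $ j\<bar> \<le> \<delta>" for i j
  proof -
    have "\<bar>(Pt A - plan A) $ i $ j\<bar> \<le> max_norm (Pt A - plan A)"
      unfolding max_norm_def by (rule Max_ge) (auto intro!: image_eqI[where x="(i, j)"])
    then show ?thesis using assms by (simp add: delta_oracle_def)
  qed
  have "approx_grad x y Pt A - grad A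
      = - 32 *\<^sub>R (\<Sum>i\<in>UNIV. \<Sum>j\<in>UNIV. (Pt A $ i $ j - plan A $ i $ j) *\<^sub>R outer (x i) (y j))"
    by (simp add: approx_grad_def grad_def barycenter_def sum_subtractf scaleR_left_diff_distrib
        scaleR_right_diff_distrib)
  then have "norm (approx_grad x y Pt A - grad A)
      = 32 * norm (\<Sum>i\<in>UNIV. \<Sum>j\<in>UNIV. (Pt A $ i $ j - plan A $ i $ j) *\<^sub>R outer (x i) (y j))"
    by simp
  also have "\<dots> \<le> 32 * (\<Sum>i\<in>UNIV. \<Sum>j\<in>UNIV. norm ((Pt A $ i $ j - plan A $ i $ j) *\<^sub>R outer (x i) (y j)))"
    by (intro mult_left_mono order_trans[OF norm_sum] sum_mono norm_sum) simp
  also have "\<dots> \<le> 32 * (\<Sum>i\<in>UNIV. \<Sum>j\<in>UNIV. \<delta> * (norm (x i) * norm (y j)))"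
    using entry by (intro mult_left_mono sum_mono) (auto simp: norm_outer intro!: mult_right_mono)
  finally show ?thesis by (simp add: sum_distrib_left mult_ac)
qed

end

section \<open>Gradients\<close>

text \<open>Subtracting the linear and quadratic terms leaves a function with a maximum at
  \<open>u\<close>, where its derivative \<open>G - g\<close> must vanish.\<close>

lemma GDERIV_eq_of_upper_bound:
  fixes f :: "'a::euclidean_space \<Rightarrow> real"
  assumes "GDERIV f u :> G"
    and upper: "\<And>v. f v \<le> f u + g \<bullet> (v - u) + K * (norm (v - u))\<^sup>2"
  shows "G = g"
proof -
  define \<phi> where "\<phi> v = f v - g \<bullet> (v - u) - K * ((v - u) \<bullet> (v - u))" for v
  have "(f has_derivative (\<lambda>h. h \<bullet> G)) (at u)"
    using assms(1) by (simp add: gderiv_def)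
  then have "(\<phi> has_derivative (\<lambda>h. h \<bullet> G - g \<bullet> h)) (at u)"
    unfolding \<phi>_def by (auto intro!: derivative_eq_intros)
  moreover have "\<forall>v\<in>UNIV. \<phi> v \<le> \<phi> u"
    using upper by (simp add: \<phi>_def power2_norm_eq_inner) (simp add: algebra_simps)
  ultimately have "(\<lambda>h. h \<bullet> G - g \<bullet> h) = (\<lambda>h. 0)"
    by (intro differential_zero_maxmin[of u UNIV]) auto
  \<comment> \<open>The vanishing derivative is evaluated in the direction
    \<open>G - g\<close>.\<close>
  then have "(G - g) \<bullet> G - g \<bullet> (G - g) = 0" by meson
  then have "(G - g) \<bullet> (G - g) = 0" by (simp add: inner_diff_left inner_diff_right inner_commute)
  then show ?thesis by simp
qed

text \<open>By convexity the difference quotients towards \<open>v\<close> are at most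
  \<open>f v - f u\<close>. The limit is taken from the right, since negative \<open>t\<close> may
  lead out of \<open>S\<close>.\<close>

lemma convex_on_GDERIV_lower:
  fixes f :: "'a::euclidean_space \<Rightarrow> real"
  assumes cvx: "convex_on S f" and u: "u \<in> S" and v: "v \<in> S" and G: "GDERIV f u :> G"
  shows "f u + G \<bullet> (v - u) \<le> f v"
proof -
  define \<phi> where "\<phi> t = f (u + t *\<^sub>R (v - u))" for t
  have "(f has_derivative (\<lambda>h. h \<bullet> G)) (at (u + 0 *\<^sub>R (v - u)))"
    using G by (simp add: gderiv_def)
  moreover have "((\<lambda>t. u + t *\<^sub>R (v - u)) has_derivative (\<lambda>t. t *\<^sub>R (v - u))) (at 0)"
    by (auto intro!: derivative_eq_intros)
  ultimately have "(\<phi> has_derivative (\<lambda>t. (t *\<^sub>R (v - u)) \<bullet> G)) (at 0)"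
    unfolding \<phi>_def by (rule has_derivative_compose[rotated])
  then have "(\<phi> has_field_derivative (G \<bullet> (v - u))) (at 0)"
    by (simp add: has_field_derivative_def inner_commute mult_commute_abs)
  then have "((\<lambda>t. (\<phi> t - \<phi> 0) / t) \<longlongrightarrow> G \<bullet> (v - u)) (at_right 0)"
    by (auto simp: DERIV_def intro: filterlim_mono at_le)
  moreover have "eventually (\<lambda>t. (\<phi> t - \<phi> 0) / t \<le> f v - f u) (at_right 0)"
  proof -
    have "(\<phi> t - \<phi> 0) / t \<le> f v - f u" if "0 < t" "t < 1" for t
    proof -
      have "u + t *\<^sub>R (v - u) = (1 - t) *\<^sub>R u + t *\<^sub>R v" by (simp add: algebra_simps)
      then have "\<phi> t \<le> (1 - t) * f u + t * f v"
        using convex_onD[OF cvx, of t u v] u v that by (simp add: \<phi>_def)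
      then have "\<phi> t - \<phi> 0 \<le> t * (f v - f u)" by (simp add: \<phi>_def algebra_simps)
      then show ?thesis using that by (simp add: divide_le_eq mult.commute)
    qed
    then show ?thesis
      using eventually_at_right_less[of 0] eventually_at_right_real[of 0 "1::real"]
      by (auto elim!: eventually_mono)
  qed
  ultimately have "G \<bullet> (v - u) \<le> f v - f u"
    by (intro tendsto_upperbound) auto
  then show ?thesis by simp
qed

text \<open>\<open>n\<close> rounds up the larger root of
  \<open>(t + 1) * (t + 2) = c / \<gamma>\<close>, which is
  \<open>(2 * t + 3)\<^sup>2 = 1 + 4 * c / \<gamma>\<close>. Where the ceiling is negative,
  \<open>nat\<close> only increases it.\<close>

lemma iteration_count:
  fixes c \<gamma> :: real
  assumes "0 \<le> c" "0 < \<gamma>"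
  defines "n \<equiv> nat \<lceil>- 3/2 + 1/2 * sqrt (1 + 4 * c / \<gamma>)\<rceil>"
  shows "c / ((real n + 1) * (real n + 2)) \<le> \<gamma>"
proof -
  have "- 3/2 + 1/2 * sqrt (1 + 4 * c / \<gamma>) \<le> real n"
    unfolding n_def by linarith
  then have "sqrt (1 + 4 * c / \<gamma>) \<le> 2 * real n + 3" by simp
  moreover have "0 \<le> 1 + 4 * c / \<gamma>" using assms by simp
  ultimately have "1 + 4 * c / \<gamma> \<le> (2 * real n + 3)\<^sup>2"
    by (metis real_sqrt_ge_zero power_mono real_sqrt_pow2)
  then have "4 * (c / \<gamma>) \<le> 4 * ((real n + 1) * (real n + 2))"
    by (simp add: power2_eq_square algebra_simps)
  then have "c / \<gamma> \<le> (real n + 1) * (real n + 2)" by linarith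
  then have "c \<le> (real n + 1) * (real n + 2) * \<gamma>"
    using assms by (simp add: pos_divide_le_eq)
  moreover have "0 < (real n + 1) * (real n + 2)" by (intro mult_pos_pos) auto
  ultimately show ?thesis by (simp add: pos_divide_le_eq mult.commute)
qed

section \<open>Convergence rate and iteration count for the entropic objective\<close>

theorem theorem9:
  fixes a :: "'n0::finite \<Rightarrow> real" and b :: "'n1::finite \<Rightarrow> real"
    and x :: "'n0 \<Rightarrow> real^'d0::finite" and y :: "'n1 \<Rightarrow> real^'d1::finite"
    and \<mu>0 :: "(real^'d0) measure" and \<mu>1 :: "(real^'d1) measure"
    and \<epsilon> M \<delta> \<delta>' L :: real
    and \<Phi> :: "real^'d1^'d0 \<Rightarrow> real"
    and Pt :: "real^'d1^'d0 \<Rightarrow> real^'n1^'n0"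
    and B :: "nat \<Rightarrow> real^'d1^'d0" and Bstar :: "real^'d1^'d0"
  assumes "\<And>i. 0 \<le> a i" and "(\<Sum>i\<in>UNIV. a i) = 1" and "inj x"
    and "\<And>j. 0 \<le> b j" and "(\<Sum>j\<in>UNIV. b j) = 1" and "inj y"
    and "\<mu>0 = atomic_measure a x" and "\<mu>1 = atomic_measure b y"
    and "\<epsilon> > 0" and "M > M_prod \<mu>0 \<mu>1" and "L = 64"
    and "\<Phi> = Phi \<epsilon> \<mu>0 \<mu>1"
    and "convex_on (D_ball M) \<Phi>" and "smooth_on L (D_ball M) \<Phi>"
    and "\<And>A. A \<in> D_ball M \<Longrightarrow> delta_oracle \<delta> (Pt A) (opt_plan \<epsilon> \<mu>0 \<mu>1 x y A)"
    and "B = fgm_B L M (approx_grad x y Pt)"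
    and "\<And>A. \<Phi> Bstar \<le> \<Phi> A"
    and "\<delta>' = 32 * M * \<delta> * (\<Sum>i\<in>UNIV. \<Sum>j\<in>UNIV. norm (x i) * norm (y j))"
  shows "(\<forall>k. \<Phi> (B k) - \<Phi> Bstar
              \<le> 2 * L * (norm Bstar)\<^sup>2 / ((real k + 1) * (real k + 2)) + 3 * \<delta>')
       \<and> (\<forall>\<eta>. \<eta> > 3 * \<delta>' \<longrightarrow>
            (let k = \<lceil>- 3/2 + 1/2 * sqrt (1 + 8 * L * (norm Bstar)\<^sup>2 / (\<eta> - 3 * \<delta>'))\<rceil>
             in \<Phi> (B (nat k)) - \<Phi> Bstar \<le> \<eta>
              \<and> k \<le> \<lceil>- 3/2 + 1/2 * sqrt (1 + 128 * M\<^sup>2 / (\<eta> - 3 * \<delta>'))\<rceil>))"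
proof -
  interpret T: discrete_transport a b x y \<epsilon>
    using assms(1-6,9) by unfold_locales auto
  define e where "e = 32 * \<delta> * (\<Sum>i\<in>UNIV. \<Sum>j\<in>UNIV. norm (x i) * norm (y j))"
  have \<Phi>: "\<Phi> = Phi \<epsilon> (atomic_measure a x) (atomic_measure b y)" and L: "L = 64"
    and B: "B = fgm_B 64 M (approx_grad x y Pt)"
    using assms(7,8,11,12,16) by simp_all
  have M: "M > M_prod (atomic_measure a x) (atomic_measure b y)"
    using assms(7,8,10) by simp
  moreover have "0 \<le> M_prod (atomic_measure a x) (atomic_measure b y)"
    by (simp add: M_prod_def moment_def)
  ultimately have M_pos: "M > 0" by linarith
  have ball: "A \<in> D_ball M \<longleftrightarrow> norm A \<le> M / 2" for A :: "real^'d1^'d0"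
    by (simp add: D_ball_def)
  obtain G where G: "\<And>A. A \<in> D_ball M \<Longrightarrow> GDERIV \<Phi> A :> G A"
    using assms(14) unfolding smooth_on_def by blast
  \<comment> \<open>Smoothness provides some gradient field; the global upper bound identifies it,
    so the tangent inequality from convexity holds for \<open>T.grad\<close>.\<close>
  have grad: "G A = T.grad A" if "A \<in> D_ball M" for A
    using GDERIV_eq_of_upper_bound[OF G[OF that]] T.Phi_upper[of _ A] unfolding \<Phi> by blast
  have min: "\<And>A. Phi \<epsilon> (atomic_measure a x) (atomic_measure b y) Bstar
      \<le> Phi \<epsilon> (atomic_measure a x) (atomic_measure b y) A"
    using assms(17) unfolding \<Phi> .
  have Bstar: "norm Bstar \<le> M / 2"
    using T.norm_minimizer_le[OF min] M by simp
  interpret F: inexact_fgm 64 M e \<Phi> T.grad "approx_grad x y Pt" Bstar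
  proof
    show "\<Phi> v \<le> \<Phi> u + T.grad u \<bullet> (v - u) + 64 / 2 * (norm (v - u))\<^sup>2" for u v
      using T.Phi_upper[of v u] by (simp add: \<Phi>)
    show "\<Phi> u + T.grad u \<bullet> (v - u) \<le> \<Phi> v" if "norm u \<le> M / 2" "norm v \<le> M / 2" for u v
      using convex_on_GDERIV_lower[OF assms(13) _ _ G] grad that by (simp add: ball)
    show "norm (approx_grad x y Pt u - T.grad u) \<le> e" if "norm u \<le> M / 2" for u
      unfolding e_def using assms(7,8,15) that by (intro T.approx_grad_error) (simp add: ball)
    show "T.grad Bstar = 0" by (rule T.grad_minimizer[OF min])
  qed (use M_pos Bstar in auto)
  have "\<delta>' = M * e" by (simp add: assms(18) e_def)
  then have bound: "\<Phi> (B k) - \<Phi> Bstar \<le> 2 * L * (norm Bstar)\<^sup>2 / ((real k + 1) * (real k + 2)) + 3 * \<delta>'"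
    for k
    using F.gap_bound[of k] by (simp add: B F.fgm_B_eq L F.b_def)
  have "\<Phi> (B (nat \<lceil>- 3/2 + 1/2 * sqrt (1 + 8 * L * (norm Bstar)\<^sup>2 / (\<eta> - 3 * \<delta>'))\<rceil>)) - \<Phi> Bstar \<le> \<eta>
      \<and> \<lceil>- 3/2 + 1/2 * sqrt (1 + 8 * L * (norm Bstar)\<^sup>2 / (\<eta> - 3 * \<delta>'))\<rceil>
          \<le> \<lceil>- 3/2 + 1/2 * sqrt (1 + 128 * M\<^sup>2 / (\<eta> - 3 * \<delta>'))\<rceil>"
    if \<eta>: "\<eta> > 3 * \<delta>'" for \<eta>
  proof
    define n where "n = nat \<lceil>- 3/2 + 1/2 * sqrt (1 + 8 * L * (norm Bstar)\<^sup>2 / (\<eta> - 3 * \<delta>'))\<rceil>"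
    \<comment> \<open>With \<open>c = 2 * L * (norm Bstar)\<^sup>2\<close> the \<open>4 * c\<close>
      of \<open>iteration_count\<close> is the \<open>8 * L * (norm Bstar)\<^sup>2\<close> under the
      root.\<close>
    have "2 * L * (norm Bstar)\<^sup>2 / ((real n + 1) * (real n + 2)) \<le> \<eta> - 3 * \<delta>'"
      using iteration_count[of "2 * L * (norm Bstar)\<^sup>2" "\<eta> - 3 * \<delta>'"] \<eta> unfolding n_def
      by (simp add: L)
    then show "\<Phi> (B n) - \<Phi> Bstar \<le> \<eta>" using bound[of n] by linarith
    have "(norm Bstar)\<^sup>2 \<le> (M / 2)\<^sup>2" using Bstar by (intro power_mono) auto
    then have "8 * L * (norm Bstar)\<^sup>2 \<le> 128 * M\<^sup>2" by (simp add: L power_divide)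
    then have "8 * L * (norm Bstar)\<^sup>2 / (\<eta> - 3 * \<delta>') \<le> 128 * M\<^sup>2 / (\<eta> - 3 * \<delta>')"
      using \<eta> by (intro divide_right_mono) auto
    then show "\<lceil>- 3/2 + 1/2 * sqrt (1 + 8 * L * (norm Bstar)\<^sup>2 / (\<eta> - 3 * \<delta>'))\<rceil>
          \<le> \<lceil>- 3/2 + 1/2 * sqrt (1 + 128 * M\<^sup>2 / (\<eta> - 3 * \<delta>'))\<rceil>"
      by (intro ceiling_mono add_left_mono mult_left_mono real_sqrt_le_mono) auto
  qed
  then show ?thesis using bound unfolding Let_def by blast
qed

end
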